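(* Let $n\ge 4$ and consider the TSP instance $G_1$ on the complete graph with vertex set $V=\{1,\dots,n\}$ whose distance function is $d(\{i,i+1\})=1$ for $i=1,\dots,n-1$, $d(\{n,1\})=1$, and $d(e)=n$ for every other edge $e$; its unique optimal Hamiltonian cycle is $s^*=(1,2,\dots,n)$. Run the cross-entropy algorithm described in the context (with $M=1$, $\rho=1$, $\pi_{\min}=\frac{1}{n(n-2)}$, $\pi_{\max}=1-\frac1n$) on this instance. Then, as $n\to\infty$: (a) if the vertex-based random solution generation is used and the sample size satisfies $N\in\Omega(n^{5+\epsilon})$ for a constant $\epsilon\in(0,1)$, then with probability at least $1-e^{-\Omega(N/n^{5})}$ the optimal solution $s^*$ is found within $n$ iterations; (b) if the edge-based random solution generation is used and $N\in\Omega(n^{3+\epsilon})$ for a constant $\epsilon\in(0,1)$, then with probability at least $1-e^{-\Omega(N/n^{3})}$ the optimal solution $s^*$ is found within $n$ iterations.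
   Context: Let $K_n$ be the complete graph on $V=\{1,\dots,n\}$ with edge set $E$ of all 2-element subsets. A feasible solution is a Hamiltonian cycle of $K_n$ (identified with any permutation listing its vertices in cyclic order); its cost $f(s)$ is the sum of $d$ over its $n$ edges. For a Hamiltonian cycle $H$, let $\Pi^H=(\pi_{i,j})$ be the symmetric $n\times n$ matrix with $\pi_{i,i}=0$, $\pi_{i,j}=\pi_{\max}=1-\frac1n$ if $\{i,j\}\in H$ and $\pi_{i,j}=\pi_{\min}=\frac{1}{n(n-2)}$ otherwise. Vertex-based generation from a matrix $\Pi$: pick a start vertex uniformly at random; while unvisited vertices remain, from the current vertex $v$ move to an unvisited vertex $v'$ chosen with probability $\pi_{v,v'}/\sum_{k\text{ unvisited}}\pi_{v,k}$; output the Hamiltonian cycle visiting vertices in this order. Edge-based generation from $\Pi$: start with $B=\emptyset$ and repeatedly add to $B$ an edge $\{i,j\}\notin B$ chosen among the admissible edges with probability proportional to $\pi_{i,j}+\pi_{j,i}$, until $B$ is a Hamiltonian cycle; an edge is admissible if adding it to $B$ creates no vertex of degree $\ge3$ and no cycle with fewer than $n$ edges. The algorithm: $\Pi_0$ has all off-diagonal entries $\frac{1}{n-1}$ (zero diagonal). In iteration $t=0,1,2,\dots$, generate $N$ independent random solutions $X_t^{(1)},\dots,X_t^{(N)}$ from $\Pi_t$ with the chosen generation method, let $X_t^{[1]}$ be one of them of minimum cost, and set $\Pi_{t+1}=\Pi^{X_t^{[1]}}$ (this is the cross-entropy update with elite size $M=1$, smoothing parameter $\rho=1$, followed by max-min calibration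 clamping entries into $[\pi_{\min},\pi_{\max}]$). The optimal solution is found within $T$ iterations if $X_t^{[1]}$ is optimal for some $t\le T$. Asymptotic notation refers to $n\to\infty$, with $N=N(n)$. *)

theory Defs
  imports "HOL-Probability.Probability" "HOL-Library.Landau_Symbols"
begin

type_synonym sol = "nat set set"   (* a Hamiltonian cycle, as its set of (undirected) edges *)
type_synonym mat = "nat \<Rightarrow> nat \<Rightarrow> real"

definition cyc_edges :: "nat list \<Rightarrow> sol" where
  "cyc_edges vs = {{vs ! i, vs ! ((i + 1) mod length vs)} | i. i < length vs}"

definition is_ham :: "nat \<Rightarrow> sol \<Rightarrow> bool" where
  "is_ham n H \<longleftrightarrow> (\<exists>vs. distinct vs \<and> set vs = {1..n} \<and> H = cyc_edges vs)"

definition kn_edges :: "nat \<Rightarrow> sol" where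
  "kn_edges n = {{i, j} | i j. i \<in> {1..n} \<and> j \<in> {1..n} \<and> i \<noteq> j}"

definition cost :: "(nat set \<Rightarrow> real) \<Rightarrow> sol \<Rightarrow> real" where
  "cost d H = (\<Sum>e\<in>H. d e)"

definition is_opt :: "nat \<Rightarrow> (nat set \<Rightarrow> real) \<Rightarrow> sol \<Rightarrow> bool" where
  "is_opt n d H \<longleftrightarrow> is_ham n H \<and> (\<forall>H'. is_ham n H' \<longrightarrow> cost d H \<le> cost d H')"

definition dist_G1 :: "nat \<Rightarrow> nat set \<Rightarrow> real" where
  "dist_G1 n e = (if (\<exists>i\<in>{1..<n}. e = {i, Suc i}) \<or> e = {n, 1} then 1 else real n)"

definition pi_min :: "nat \<Rightarrow> real" where "pi_min n = 1 / (real n * (real n - 2))"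
definition pi_max :: "nat \<Rightarrow> real" where "pi_max n = 1 - 1 / real n"

definition pi_of :: "nat \<Rightarrow> sol \<Rightarrow> mat" where
  "pi_of n H i j = (if i = j then 0 else if {i, j} \<in> H then pi_max n else pi_min n)"

definition pi0 :: "nat \<Rightarrow> mat" where
  "pi0 n i j = (if i = j then 0 else 1 / (real n - 1))"

definition weighted_pmf :: "('a \<Rightarrow> real) \<Rightarrow> 'a set \<Rightarrow> 'a pmf" where
  "weighted_pmf w A = embed_pmf (\<lambda>x. if x \<in> A then w x / (\<Sum>y\<in>A. w y) else 0)"

fun vwalk :: "nat \<Rightarrow> mat \<Rightarrow> nat set \<Rightarrow> nat \<Rightarrow> nat list pmf" where
  "vwalk 0 P U v = return_pmf []"
| "vwalk (Suc k) P U v =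
     bind_pmf (weighted_pmf (P v) U) (\<lambda>v'. map_pmf (Cons v') (vwalk k P (U - {v'}) v'))"

definition vertex_gen :: "nat \<Rightarrow> mat \<Rightarrow> sol pmf" where
  "vertex_gen n P = bind_pmf (pmf_of_set {1..n})
     (\<lambda>v. map_pmf (\<lambda>vs. cyc_edges (v # vs)) (vwalk (n - 1) P ({1..n} - {v}) v))"

definition deg :: "sol \<Rightarrow> nat \<Rightarrow> nat" where
  "deg E v = card {e \<in> E. v \<in> e}"

definition has_short_cycle :: "nat \<Rightarrow> sol \<Rightarrow> bool" where
  "has_short_cycle n E \<longleftrightarrow>
     (\<exists>vs. distinct vs \<and> 3 \<le> length vs \<and> length vs < n \<and> cyc_edges vs \<subseteq> E)"

definition admissible :: "nat \<Rightarrow> sol \<Rightarrow> sol" where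
  "admissible n B = {e \<in> kn_edges n. e \<notin> B \<and> (\<forall>v. deg (insert e B) v < 3)
                      \<and> \<not> has_short_cycle n (insert e B)}"

definition edge_weight :: "mat \<Rightarrow> nat set \<Rightarrow> real" where
  "edge_weight P e = P (Min e) (Max e) + P (Max e) (Min e)"

fun ebuild :: "nat \<Rightarrow> nat \<Rightarrow> mat \<Rightarrow> sol \<Rightarrow> sol pmf" where
  "ebuild n 0 P B = return_pmf B"
| "ebuild n (Suc k) P B = (if is_ham n B then return_pmf B
     else bind_pmf (weighted_pmf (edge_weight P) (admissible n B)) (\<lambda>e. ebuild n k P (insert e B)))"

definition edge_gen :: "nat \<Rightarrow> mat \<Rightarrow> sol pmf" where
  "edge_gen n P = ebuild n n P {}"

fun samples :: "nat \<Rightarrow> 'a pmf \<Rightarrow> 'a list pmf" where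
  "samples 0 p = return_pmf []"
| "samples (Suc k) p = bind_pmf p (\<lambda>x. map_pmf (Cons x) (samples k p))"

(* Cross-entropy run with M = 1, rho = 1, max-min calibration: returns True iff the
   selected best sample X_t^[1] is optimal for some t \<le> T (T counts remaining iterations). *)
fun ce_found :: "(mat \<Rightarrow> sol pmf) \<Rightarrow> (sol list \<Rightarrow> sol) \<Rightarrow> (sol \<Rightarrow> bool) \<Rightarrow> (sol \<Rightarrow> mat)
                 \<Rightarrow> nat \<Rightarrow> nat \<Rightarrow> mat \<Rightarrow> bool pmf" where
  "ce_found gen sel opt upd N 0 P =
     map_pmf (\<lambda>xs. opt (sel xs)) (samples N (gen P))"
| "ce_found gen sel opt upd N (Suc T) P =
     bind_pmf (samples N (gen P)) (\<lambda>xs.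
       if opt (sel xs) then return_pmf True else ce_found gen sel opt upd N T (upd (sel xs)))"

definition valid_sel :: "(nat \<Rightarrow> sol list \<Rightarrow> sol) \<Rightarrow> bool" where
  "valid_sel sel \<longleftrightarrow> (\<forall>n xs. xs \<noteq> [] \<longrightarrow> sel n xs \<in> set xs \<and>
      (\<forall>y\<in>set xs. cost (dist_G1 n) (sel n xs) \<le> cost (dist_G1 n) y))"

(* probability that the optimum is found within T iterations (t = 0..T) *)
definition success_prob :: "(nat \<Rightarrow> mat \<Rightarrow> sol pmf) \<Rightarrow> (nat \<Rightarrow> sol list \<Rightarrow> sol)
                            \<Rightarrow> nat \<Rightarrow> nat \<Rightarrow> nat \<Rightarrow> real" where
  "success_prob gen sel N T n =
     pmf (ce_found (gen n) (sel n) (is_opt n (dist_G1 n)) (pi_of n) N T (pi0 n)) True"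

end

theory Submission
  imports Defs "HOL-Real_Asymp.Real_Asymp"
begin

text \<open>A Hamiltonian cycle with \<open>k\<close> cheap edges costs \<open>k + (n - k) n\<close>, so it suffices that each
  iteration after the first one raises \<open>k\<close> with high probability. If the cheap edge \<open>x = {i, j}\<close> is
  missing from \<open>H\<close>, either a 2-exchange or a 3-exchange inserts \<open>x\<close> and removes only expensive edges;
  a 3-exchange is needed when the two neighbouring cheap fragments have the same orientation, and
  then a third expensive edge exists because the cheap edges contain no short cycle.

  In the vertex-based generation the new cycle is produced by a walk that starts at an end of \<open>x\<close> and uses
  at most two edges outside \<open>H\<close>, with probability of order \<open>1/n\<close> for the start and \<open>1/n\<^sup>2\<close> for each
  of the two edges. In the edge-based generation it is produced with probability of order \<open>1/n\<^sup>3\<close>;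
  here one exploits that \<open>x\<close> may be inserted at any time and blocks unwanted edges afterwards. With
  success probability \<open>p\<close> per sample, all \<open>n\<close> steps succeed except with probability
  \<open>n (1 - p)\<^sup>N \<le> n e\<^sup>-\<^sup>p\<^sup>N\<close>, and \<open>pN\<close> dominates \<open>ln n\<close>.\<close>

section \<open>Edge sets of paths and Hamiltonian cycles\<close>

text \<open>In the vertex-based case the walk starts and ends at the two ends of \<open>x\<close>,
  so \<open>x\<close> is the closing edge and is never drawn. The steps along \<open>H\<close> may
  lose only a constant factor altogether; this works because
  \<open>pi_max n + (n - 2) * pi_min n = 1\<close> and
  \<open>pi_max n ^ (n - 1) \<ge> exp (- 1)\<close>. In the edge-based case the obstacle is the
  order of insertion. Collecting all of \<open>H - D\<close> first costs about
  \<open>1 / n^3\<close> when \<open>D\<close> has three edges, and drawing \<open>x\<close> against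
  edges of \<open>D\<close>, heavier by a factor of about \<open>n^2\<close>, costs another
  \<open>1 / n^2\<close>. Summing over all insertion times of \<open>x\<close> avoids this loss.
  Once \<open>x\<close> and \<open>H - D\<close> are present, no edge of \<open>H\<close> is
  admissible, so any further new edge competes only with boundedly many edges of its own weight. A
  separate difficulty is that the weights define a distribution only while admissible edges exist.
  Partial solutions are therefore shown to be linear forests, which always extend to a Hamiltonian
  cycle.\<close>

fun path_edges :: "nat list \<Rightarrow> sol" where
  "path_edges [] = {}"
| "path_edges [a] = {}"
| "path_edges (a # b # xs) = insert {a, b} (path_edges (b # xs))"

lemma path_edges_Cons: "xs \<noteq> [] \<Longrightarrow> path_edges (a # xs) = insert {a, hd xs} (path_edges xs)"
  by (cases xs) auto

lemma path_edges_append: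
  "xs \<noteq> [] \<Longrightarrow> ys \<noteq> [] \<Longrightarrow>
    path_edges (xs @ ys) = insert {last xs, hd ys} (path_edges xs \<union> path_edges ys)"
  by (induction xs rule: path_edges.induct) (auto simp: path_edges_Cons)

lemma path_edges_rev [simp]: "path_edges (rev xs) = path_edges xs"
proof (induction xs)
  case (Cons a xs)
  then show ?case
    by (cases "xs = []") (auto simp: path_edges_append path_edges_Cons last_rev insert_commute)
qed auto

lemma path_edges_subset: "e \<in> path_edges xs \<Longrightarrow> e \<subseteq> set xs"
  by (induction xs rule: path_edges.induct) auto

lemma finite_path_edges [simp]: "finite (path_edges xs)"
  by (induction xs rule: path_edges.induct) auto

lemma path_edges_conv_nth:
  "path_edges xs = {{xs ! i, xs ! Suc i} | i. Suc i < length xs}"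
proof (induction xs rule: path_edges.induct)
  case (3 a b xs)
  have "{{(a # b # xs) ! i, (a # b # xs) ! Suc i} | i. Suc i < length (a # b # xs)}
      = insert {a, b} {{(b # xs) ! i, (b # xs) ! Suc i} | i. Suc i < length (b # xs)}"
    (is "?L = insert _ ?R")
  proof (intro set_eqI iffI)
    fix e assume "e \<in> ?L"
    then obtain i where "e = {(a # b # xs) ! i, (a # b # xs) ! Suc i}" "Suc i < length (a # b # xs)"
      by blast
    then show "e \<in> insert {a, b} ?R" by (cases i) auto
  next
    fix e assume "e \<in> insert {a, b} ?R"
    then consider "e = {a, b}"
      | i where "e = {(b # xs) ! i, (b # xs) ! Suc i}" "Suc i < length (b # xs)"
      by blast
    then show "e \<in> ?L"
    proof cases
      case 1 then show ?thesis by (auto intro!: exI[of _ 0])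
    next
      case 2 then show ?thesis by (auto intro!: exI[of _ "Suc i"])
    qed
  qed
  with 3 show ?case by simp
qed auto

lemma cyc_edges_conv_path:
  assumes "vs \<noteq> []"
  shows "cyc_edges vs = insert {last vs, hd vs} (path_edges vs)"
proof (intro set_eqI iffI)
  fix e assume "e \<in> cyc_edges vs"
  then obtain i where i: "e = {vs ! i, vs ! ((i + 1) mod length vs)}" "i < length vs"
    unfolding cyc_edges_def by blast
  show "e \<in> insert {last vs, hd vs} (path_edges vs)"
  proof (cases "Suc i = length vs")
    case True
    then have "i = length vs - 1" by simp
    with i True assms show ?thesis by (simp add: last_conv_nth hd_conv_nth)
  next
    case False
    with i show ?thesis by (auto simp: path_edges_conv_nth)
  qed
next
  fix e assume "e \<in> insert {last vs, hd vs} (path_edges vs)"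
  then consider "e = {last vs, hd vs}" | i where "e = {vs ! i, vs ! Suc i}" "Suc i < length vs"
    by (auto simp: path_edges_conv_nth)
  then show "e \<in> cyc_edges vs"
  proof cases
    case 1
    with assms show ?thesis
      by (auto simp: cyc_edges_def last_conv_nth hd_conv_nth intro!: exI[of _ "length vs - 1"])
  next
    case 2
    then show ?thesis unfolding cyc_edges_def by (auto intro!: exI[of _ i])
  qed
qed

lemma cyc_edges_swap: "cyc_edges (xs @ ys) = cyc_edges (ys @ xs)"
  by (cases "xs = []"; cases "ys = []")
     (auto simp: cyc_edges_conv_path path_edges_append)

lemma cyc_edges_rev: "cyc_edges (rev xs) = cyc_edges xs"
  by (cases "xs = []") (auto simp: cyc_edges_conv_path hd_rev last_rev insert_commute)

lemma cyc_edges_Cons: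
  "ws \<noteq> [] \<Longrightarrow> cyc_edges (v # ws) = insert {v, last ws} (insert {v, hd ws} (path_edges ws))"
  by (auto simp: cyc_edges_conv_path path_edges_Cons insert_commute)

lemma incident_cyc_edges:
  assumes "v \<notin> set ws" "ws \<noteq> []"
  shows "{e \<in> cyc_edges (v # ws). v \<in> e} = {{v, hd ws}, {v, last ws}}"
  using assms path_edges_subset by (fastforce simp: cyc_edges_Cons)

lemma finite_cyc_edges [simp]: "finite (cyc_edges vs)"
  by (cases "vs = []") (auto simp: cyc_edges_conv_path cyc_edges_def)

lemma card_path_edges: "distinct xs \<Longrightarrow> card (path_edges xs) = length xs - 1"
proof (induction xs rule: path_edges.induct)
  case (3 a b xs)
  then have "{a, b} \<notin> path_edges (b # xs)" using path_edges_subset by fastforce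
  with 3 show ?case by simp
qed auto

lemma hd_neq_last: "distinct ws \<Longrightarrow> 2 \<le> length ws \<Longrightarrow> hd ws \<noteq> last ws"
  by (cases ws) auto

lemma card_cyc_edges:
  assumes "distinct vs" "3 \<le> length vs"
  shows "card (cyc_edges vs) = length vs"
proof -
  obtain v ws where vs: "vs = v # ws" using assms by (cases vs) auto
  have ne: "hd ws \<noteq> last ws" using assms vs by (intro hd_neq_last) auto
  have ws: "ws \<noteq> []" "v \<notin> set ws" using assms vs by auto
  then have "{v, hd ws} \<notin> path_edges ws" "{v, last ws} \<notin> path_edges ws"
    using path_edges_subset by blast+
  then show ?thesis
    using ne ws assms vs by (auto simp: cyc_edges_Cons card_path_edges doubleton_eq_iff)
qed

lemma rotate_to_front:
  assumes "distinct vs" "v \<in> set vs"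
  obtains ws where "distinct (v # ws)" "set (v # ws) = set vs" "length (v # ws) = length vs"
    "cyc_edges (v # ws) = cyc_edges vs"
proof -
  from assms obtain xs ys where vs: "vs = xs @ v # ys" by (meson split_list)
  show thesis
  proof (rule that[of "ys @ xs"])
    show "cyc_edges (v # ys @ xs) = cyc_edges vs"
      using cyc_edges_swap[of xs "v # ys"] vs by simp
  qed (use assms vs in auto)
qed

lemma path_edges_pair:
  "e \<in> path_edges xs \<Longrightarrow> distinct xs \<Longrightarrow> \<exists>a b. e = {a, b} \<and> a \<noteq> b \<and> a \<in> set xs \<and> b \<in> set xs"
  by (induction xs rule: path_edges.induct) auto

lemma cyc_edges_pair:
  assumes "e \<in> cyc_edges vs" "distinct vs" "2 \<le> length vs"
  shows "\<exists>a b. e = {a, b} \<and> a \<noteq> b \<and> a \<in> set vs \<and> b \<in> set vs"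
proof -
  have "vs \<noteq> []" "hd vs \<noteq> last vs" using assms hd_neq_last by auto
  then have "e = {last vs, hd vs} \<or> e \<in> path_edges vs"
    using assms by (simp add: cyc_edges_conv_path)
  then show ?thesis
    using path_edges_pair[of e vs] assms(2) \<open>vs \<noteq> []\<close> \<open>hd vs \<noteq> last vs\<close> by (metis hd_in_set last_in_set)
qed

lemma is_ham_cyc:
  assumes "is_ham n H"
  obtains vs where "distinct vs" "set vs = {1..n}" "length vs = n" "H = cyc_edges vs"
proof -
  from assms obtain vs where vs: "distinct vs" "set vs = {1..n}" "H = cyc_edges vs"
    unfolding is_ham_def by blast
  then have "length vs = n" by (metis card_atLeastAtMost diff_Suc_1 distinct_card)
  with vs that show thesis by blast
qed

lemma is_ham_rotate:
  assumes "is_ham n H" "v \<in> {1..n}"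
  obtains ws where "distinct (v # ws)" "set (v # ws) = {1..n}" "length ws = n - 1"
    "H = cyc_edges (v # ws)"
proof -
  obtain vs where vs: "distinct vs" "set vs = {1..n}" "length vs = n" "H = cyc_edges vs"
    using is_ham_cyc[OF assms(1)] .
  with assms(2) have v: "v \<in> set vs" by simp
  from rotate_to_front[OF vs(1) v]
  obtain ws where "distinct (v # ws)" "set (v # ws) = set vs" "length (v # ws) = length vs"
    "cyc_edges (v # ws) = cyc_edges vs" .
  with vs show thesis by (intro that[of ws]) auto
qed

lemma is_ham_finite: "is_ham n H \<Longrightarrow> finite H"
  by (auto simp: is_ham_def)

lemma is_ham_card: "is_ham n H \<Longrightarrow> 3 \<le> n \<Longrightarrow> card H = n"
  using is_ham_cyc card_cyc_edges by metis

lemma is_ham_kn: "is_ham n H \<Longrightarrow> 2 \<le> n \<Longrightarrow> H \<subseteq> kn_edges n"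
proof
  fix e assume "is_ham n H" "2 \<le> n" "e \<in> H"
  then show "e \<in> kn_edges n"
    using cyc_edges_pair unfolding kn_edges_def by (elim is_ham_cyc) fastforce
qed

lemma finite_kn_edges [simp]: "finite (kn_edges n)"
proof -
  have "kn_edges n \<subseteq> Pow {1..n}" unfolding kn_edges_def by auto
  then show ?thesis by (rule finite_subset) simp
qed

section \<open>Degrees, short cycles and admissible edges\<close>

lemma incident_ham:
  assumes "is_ham n H" "3 \<le> n" "v \<in> {1..n}"
  obtains a b where "{e \<in> H. v \<in> e} = {{v, a}, {v, b}}" "a \<noteq> b" "a \<noteq> v" "b \<noteq> v"
proof -
  obtain ws where ws: "distinct (v # ws)" "set (v # ws) = {1..n}" "length ws = n - 1"
    "H = cyc_edges (v # ws)" using is_ham_rotate[OF assms(1,3)] .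
  have "hd ws \<noteq> last ws" using ws assms by (intro hd_neq_last) auto
  moreover have "ws \<noteq> []" using ws assms by auto
  ultimately show thesis
    using ws incident_cyc_edges[of v ws] by (intro that[of "hd ws" "last ws"]) auto
qed

lemma deg_ham: 
  assumes "is_ham n H" "3 \<le> n"
  shows "deg H v = (if v \<in> {1..n} then 2 else 0)"
proof (cases "v \<in> {1..n}")
  case True
  from incident_ham[OF assms this] obtain a b where
    "{e \<in> H. v \<in> e} = {{v, a}, {v, b}}" "a \<noteq> b" "a \<noteq> v" "b \<noteq> v" .
  with True show ?thesis by (simp add: deg_def doubleton_eq_iff)
next
  case False
  then have "{e \<in> H. v \<in> e} = {}"
    using is_ham_kn[OF assms(1)] assms(2) by (auto simp: kn_edges_def)
  with False show ?thesis by (simp only: deg_def card.empty if_False)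
qed

lemma deg_mono: "finite B' \<Longrightarrow> B \<subseteq> B' \<Longrightarrow> deg B v \<le> deg B' v"
  unfolding deg_def by (intro card_mono) auto

lemma path_closed_subset:
  assumes "\<And>a b. {a, b} \<in> path_edges xs \<Longrightarrow> a \<in> T \<Longrightarrow> b \<in> T" "xs \<noteq> []" "hd xs \<in> T"
  shows "set xs \<subseteq> T"
  using assms
proof (induction xs rule: path_edges.induct)
  case (3 a b xs)
  have "b \<in> T" using "3.prems"(1)[of a b] "3.prems"(3) by simp
  moreover have "d \<in> T" if "{c, d} \<in> path_edges (b # xs)" "c \<in> T" for c d
    using "3.prems"(1)[of c d] that by simp
  ultimately have "set (b # xs) \<subseteq> T" using "3.IH" by simp
  then show ?case using "3.prems"(3) by simp
qed auto

text \<open>A cycle inside \<open>H\<close> uses up both edges of \<open>H\<close> at each of its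
  vertices, so its vertex set is closed under adjacency in \<open>H\<close> and must be all of
  \<open>{1..n}\<close>; but it has fewer than \<open>n\<close> vertices.\<close>

lemma ham_no_short_cycle:
  assumes "is_ham n H" "3 \<le> n"
  shows "\<not> has_short_cycle n H"
proof
  assume "has_short_cycle n H"
  then obtain ws where ws: "distinct ws" "3 \<le> length ws" "length ws < n" "cyc_edges ws \<subseteq> H"
    unfolding has_short_cycle_def by blast
  have sub: "set ws \<subseteq> {1..n}"
  proof
    fix a assume "a \<in> set ws"
    from rotate_to_front[OF ws(1) this] obtain us where
      us: "distinct (a # us)" "set (a # us) = set ws" "length (a # us) = length ws"
        "cyc_edges (a # us) = cyc_edges ws" .
    then have "us \<noteq> []" using ws by auto
    then have "{a, hd us} \<in> H" using us ws by (auto simp: cyc_edges_Cons)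
    then show "a \<in> {1..n}" using is_ham_kn[OF assms(1)] assms(2) by (auto simp: kn_edges_def doubleton_eq_iff)
  qed
  have closed: "b \<in> set ws" if ab: "{a, b} \<in> H" "a \<in> set ws" for a b
  proof -
    from rotate_to_front[OF ws(1) ab(2)] obtain us where
      us: "distinct (a # us)" "set (a # us) = set ws" "length (a # us) = length ws"
        "cyc_edges (a # us) = cyc_edges ws" .
    have ne: "hd us \<noteq> last us" using us ws by (intro hd_neq_last) auto
    have "us \<noteq> []" using us ws by auto
    obtain c d where cd: "{e \<in> H. a \<in> e} = {{a, c}, {a, d}}"
      using incident_ham[OF assms] sub ab(2) by (metis subsetD)
    have "{{a, hd us}, {a, last us}} = {e \<in> cyc_edges ws. a \<in> e}"
      using incident_cyc_edges[of a us] us(1,4) \<open>us \<noteq> []\<close> by simp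
    also have "\<dots> \<subseteq> {e \<in> H. a \<in> e}" using ws(4) by blast
    finally have inc: "{{a, hd us}, {a, last us}} \<subseteq> {{a, c}, {a, d}}" unfolding cd .
    have "card {{a, hd us}, {a, last us}} = 2"
      using ne by (simp add: doubleton_eq_iff)
    moreover have "card {{a, c}, {a, d}} \<le> 2" by (simp add: card_insert_if)
    ultimately have eq: "{{a, hd us}, {a, last us}} = {{a, c}, {a, d}}"
      using inc by (intro card_seteq) auto
    have "{a, b} \<in> {e \<in> H. a \<in> e}" using ab(1) by simp
    then have "{a, b} \<in> {{a, hd us}, {a, last us}}" unfolding cd eq .
    then consider "{a, b} = {a, hd us}" | "{a, b} = {a, last us}" by blast
    then have "b \<in> set (a # us)" using \<open>us \<noteq> []\<close> 
      by cases (auto simp: doubleton_eq_iff)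
    then show ?thesis unfolding us(2) .
  qed
  obtain a where a: "a \<in> set ws" using ws by (cases ws) auto
  then obtain vs where vs: "distinct (a # vs)" "set (a # vs) = {1..n}" "H = cyc_edges (a # vs)"
    using is_ham_rotate[OF assms(1)] sub by (metis subsetD)
  have "set (a # vs) \<subseteq> set ws"
    by (rule path_closed_subset) (use a closed vs in \<open>auto simp: cyc_edges_conv_path\<close>)
  then have "n \<le> card (set ws)" using card_mono[of "set ws" "{1..n}"] unfolding vs(2) by simp
  then show False using ws distinct_card[of ws] by simp
qed

lemma has_short_cycle_mono: "has_short_cycle n B \<Longrightarrow> B \<subseteq> B' \<Longrightarrow> has_short_cycle n B'"
  unfolding has_short_cycle_def by blast

text \<open>Both admissibility conditions pass to subsets, and \<open>H\<close> itself has degree 2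
  everywhere and no short cycle. Hence no edge of a target cycle is blocked while the build stays
  inside it.\<close>

lemma admissible_sub_ham:
  assumes "is_ham n H" "3 \<le> n" "B \<subseteq> H"
  shows "H - B \<subseteq> admissible n B"
proof
  fix e assume e: "e \<in> H - B"
  then have sub: "insert e B \<subseteq> H" using assms by auto
  have "deg (insert e B) v < 3" for v
    using deg_mono[OF is_ham_finite[OF assms(1)] sub, of v] deg_ham[OF assms(1,2), of v]
    by (auto split: if_splits)
  moreover have "\<not> has_short_cycle n (insert e B)"
    using ham_no_short_cycle[OF assms(1,2)] has_short_cycle_mono[OF _ sub] by blast
  moreover have "e \<in> kn_edges n" using e is_ham_kn assms by fastforce
  ultimately show "e \<in> admissible n B" using e unfolding admissible_def by blast
qed

lemma finite_admissible [simp]: "finite (admissible n B)"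
  unfolding admissible_def by simp

section \<open>Improving exchanges\<close>

lemma path_edges_split:
  "e \<in> path_edges xs \<Longrightarrow> \<exists>ys zs. xs = ys @ zs \<and> ys \<noteq> [] \<and> zs \<noteq> [] \<and> e = {last ys, hd zs}"
proof (induction xs rule: path_edges.induct)
  case (3 a b xs)
  then consider "e = {a, b}" | "e \<in> path_edges (b # xs)" by auto
  then show ?case
  proof cases
    case 1
    then show ?thesis by (intro exI[of _ "[a]"] exI[of _ "b # xs"]) simp
  next
    case 2
    then obtain ys zs where "b # xs = ys @ zs" "ys \<noteq> []" "zs \<noteq> []" "e = {last ys, hd zs}"
      using 3 by blast
    then show ?thesis by (intro exI[of _ "a # ys"] exI[of _ zs]) simp
  qed
qed auto

section \<open>Cheap edges and cost\<close>

definition opt_edges :: "nat \<Rightarrow> sol" where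
  "opt_edges n = cyc_edges [1..<Suc n]"

definition level :: "nat \<Rightarrow> sol \<Rightarrow> nat" where
  "level n H = card (H \<inter> opt_edges n)"

lemma is_ham_opt_edges: "is_ham n (opt_edges n)"
  unfolding is_ham_def opt_edges_def by (intro exI[of _ "[1..<Suc n]"]) auto

lemma dist_G1_conv:
  assumes "1 \<le> n"
  shows "dist_G1 n e = (if e \<in> opt_edges n then 1 else real n)"
proof -
  have *: "path_edges [1..<Suc n] = {e. \<exists>i\<in>{1..<n}. e = {i, Suc i}}" (is "?L = ?R")
  proof (intro set_eqI iffI)
    fix e assume "e \<in> ?L"
    then obtain i where "e = {[1..<Suc n] ! i, [1..<Suc n] ! Suc i}" "Suc i < n"
      unfolding path_edges_conv_nth by (auto simp del: upt_Suc)
    then have "Suc i \<in> {1..<n}" "e = {Suc i, Suc (Suc i)}" by (auto simp del: upt_Suc)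
    then show "e \<in> ?R" by blast
  next
    fix e assume "e \<in> ?R"
    then obtain i where "i \<in> {1..<n}" "e = {i, Suc i}" by blast
    then show "e \<in> ?L"
      unfolding path_edges_conv_nth by (auto intro!: exI[of _ "i - 1"] simp del: upt_Suc)
  qed
  have "opt_edges n = insert {n, 1} (path_edges [1..<Suc n])"
    using assms unfolding opt_edges_def
    by (subst cyc_edges_conv_path) (simp_all add: hd_append hd_upt)
  with * show ?thesis unfolding dist_G1_def by auto
qed

text \<open>Each cheap edge saves \<open>n - 1\<close> against a cost of \<open>n\<close> per edge,
  so minimising the cost is maximising the level.\<close>

lemma cost_level:
  assumes "is_ham n H" "3 \<le> n"
  shows "cost (dist_G1 n) H = real n * real n - (real n - 1) * real (level n H)"
proof -
  have fin: "finite H" and card: "card H = n" using is_ham_finite is_ham_card assms by auto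
  have "cost (dist_G1 n) H = (\<Sum>e\<in>H. real n - (real n - 1) * (if e \<in> opt_edges n then 1 else 0))"
    unfolding cost_def using assms by (intro sum.cong) (auto simp: dist_G1_conv)
  also have "\<dots> = real n * real n - (real n - 1) * (\<Sum>e\<in>H. if e \<in> opt_edges n then 1 else 0)"
    by (simp add: sum_subtractf sum_distrib_left card)
  also have "(\<Sum>e\<in>H. if e \<in> opt_edges n then 1 else 0) = real (level n H)"
    unfolding level_def using fin by (simp add: sum.If_cases)
  finally show ?thesis .
qed

lemma level_le: "is_ham n H \<Longrightarrow> 3 \<le> n \<Longrightarrow> level n H \<le> n"
  unfolding level_def using is_ham_finite is_ham_card by (metis card_mono inf_le1)

lemma is_opt_level:
  assumes "is_ham n H" "3 \<le> n" "n \<le> level n H"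
  shows "is_opt n (dist_G1 n) H"
  unfolding is_opt_def
proof (intro conjI allI impI)
  fix H' assume "is_ham n H'"
  then have "level n H' \<le> level n H" using level_le assms by (meson le_trans)
  then have "(real n - 1) * real (level n H') \<le> (real n - 1) * real (level n H)"
    using assms by (intro mult_left_mono) auto
  then show "cost (dist_G1 n) H \<le> cost (dist_G1 n) H'"
    using cost_level assms \<open>is_ham n H'\<close> by simp
qed (use assms in auto)

lemma cost_less_iff:
  assumes "is_ham n H" "is_ham n H'" "3 \<le> n"
  shows "cost (dist_G1 n) H' < cost (dist_G1 n) H \<longleftrightarrow> level n H < level n H'"
  using assms by (simp add: cost_level)

text \<open>The edges \<open>D\<close> are dropped and \<open>x\<close> is gained. The conditions on \<open>d1\<close>, \<open>d2\<close>, \<open>e1\<close>, \<open>e2\<close> and the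
  short cycle are what keeps the edge-based generation from choosing edges of \<open>D\<close>: next to \<open>x\<close>
  and \<open>e1\<close>, the edge \<open>d1\<close> would create a vertex of degree 3.\<close>

definition is_exchange ::
  "nat \<Rightarrow> sol \<Rightarrow> sol \<Rightarrow> sol \<Rightarrow> nat set \<Rightarrow> nat set \<Rightarrow> nat set \<Rightarrow> nat set \<Rightarrow> nat set \<Rightarrow> bool" where
  "is_exchange n H H' D x d1 d2 e1 e2 \<longleftrightarrow>
     H - D \<subseteq> H' \<and> x \<in> H' - H \<and> D \<subseteq> H \<and> D \<inter> H' = {} \<and> card D \<le> 3 \<and>
     {d1, d2} \<subseteq> D \<and> d1 \<noteq> d2 \<and> {e1, e2} \<subseteq> H - D \<and> e1 \<noteq> e2 \<and>
     x \<inter> d1 \<inter> e1 \<noteq> {} \<and> x \<inter> d2 \<inter> e2 \<noteq> {} \<and>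
     (\<forall>f\<in>D - {d1, d2}. has_short_cycle n (insert f (insert x (H - D))))"

text \<open>The segment \<open>Q\<close> is reversed, and \<open>vs\<close> is the new cycle cut
  open at \<open>x\<close>, so at most \<open>{hd Q, hd R}\<close> remains outside \<open>H\<close>.
  At \<open>i\<close> and at \<open>j\<close> one edge of \<open>H\<close> is dropped and the other
  one is kept, which yields \<open>e1\<close> and \<open>e2\<close>.\<close>

lemma two_exchange:
  assumes "distinct (i # Q @ j # R)" "Q \<noteq> []" "R \<noteq> []"
  defines "H \<equiv> cyc_edges (i # Q @ j # R)"
  defines "vs \<equiv> j # rev Q @ R @ [i]"
  defines "D \<equiv> {{i, hd Q}, {j, hd R}}"
  shows "is_exchange n H (cyc_edges vs) D {i, j} {i, hd Q} {j, hd R} {last R, i} {last Q, j}"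
    and "card (path_edges vs - H) \<le> 2"
proof -
  define q r s p where "q = hd Q" and "r = last Q" and "s = hd R" and "p = last R"
  note qrsp = this
  have mem: "q \<in> set Q" "r \<in> set Q" "s \<in> set R" "p \<in> set R"
    using assms by (auto simp: qrsp)
  then have neq: "i \<noteq> j" "j \<noteq> i" "q \<noteq> i" "q \<noteq> j" "r \<noteq> i" "r \<noteq> j" "s \<noteq> i" "s \<noteq> j" "p \<noteq> i" "p \<noteq> j"
    "q \<noteq> s" "q \<noteq> p" "r \<noteq> s" "r \<noteq> p"  "s \<noteq> q" "p \<noteq> q" "s \<noteq> r" "p \<noteq> r"
    using assms(1) by auto
  have H: "H = {{i, q}, {r, j}, {j, s}, {p, i}} \<union> path_edges Q \<union> path_edges R"
    using assms(2,3) by (auto simp: H_def cyc_edges_Cons path_edges_append path_edges_Cons qrsp)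
  have P: "path_edges vs = {{j, r}, {q, s}, {p, i}} \<union> path_edges Q \<union> path_edges R"
    using assms(2,3) by (auto simp: vs_def path_edges_append path_edges_Cons qrsp hd_rev last_rev)
  have C: "cyc_edges vs = insert {i, j} (path_edges vs)"
    using assms(2,3) by (simp add: vs_def cyc_edges_conv_path)
  have D: "D = {{i, q}, {j, s}}" by (simp add: D_def qrsp)
  have Q: "e \<in> path_edges Q \<Longrightarrow> i \<notin> e \<and> j \<notin> e \<and> s \<notin> e \<and> p \<notin> e" for e
    using path_edges_subset[of e Q] assms(1) mem by auto
  have R: "e \<in> path_edges R \<Longrightarrow> i \<notin> e \<and> j \<notin> e \<and> q \<notin> e \<and> r \<notin> e" for e
    using path_edges_subset[of e R] assms(1) mem by auto
  have notin: "{i, j} \<notin> path_edges Q" "{i, j} \<notin> path_edges R"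
     "{i, q} \<notin> path_edges Q" "{i, q} \<notin> path_edges R" "{j, s} \<notin> path_edges Q" "{j, s} \<notin> path_edges R"
     "{p, i} \<notin> path_edges Q" "{p, i} \<notin> path_edges R" "{r, j} \<notin> path_edges Q" "{r, j} \<notin> path_edges R"
    using Q R by blast+
  have 1: "H - D \<subseteq> cyc_edges vs" unfolding C P H D by auto
  have 2: "{i, j} \<in> cyc_edges vs - H" unfolding C P H using notin neq
    by (simp add: doubleton_eq_iff)
  have 3: "D \<subseteq> H" unfolding D H by auto
  have 4: "D \<inter> cyc_edges vs = {}" unfolding D C P using notin neq
    by (simp add: doubleton_eq_iff)
  have 5: "{{p, i}, {r, j}} \<subseteq> H - D" unfolding D H using neq
    by (simp add: doubleton_eq_iff)
  have 6: "{i, q} \<noteq> {j, s}" "{p, i} \<noteq> {r, j}" using neq by (simp_all add: doubleton_eq_iff)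
  have 7: "D - {{i, q}, {j, s}} = {}" unfolding D by simp
  have 8: "card D \<le> 3" unfolding D using 6 by simp
  show "is_exchange n H (cyc_edges vs) D {i, j} {i, hd Q} {j, hd R} {last R, i} {last Q, j}"
    unfolding is_exchange_def qrsp[symmetric] using 1 2 3 4 5 6 7 8 by (auto simp: D)
  have "path_edges vs - H \<subseteq> {{q, s}}" unfolding P H by auto
  then have "card (path_edges vs - H) \<le> card {{q, s}}" by (intro card_mono) auto
  then show "card (path_edges vs - H) \<le> 2" by simp
qed

text \<open>The segment \<open>Q\<close> moves, unreversed, between \<open>R1\<close> and
  \<open>R2\<close>. The dropped edges at \<open>i\<close> and \<open>j\<close> are blocked by
  degree. The third one, \<open>{last R1, hd R2}\<close>, is blocked because with \<open>x\<close>
  and the kept edges it closes the cycle through \<open>j\<close>, \<open>R1\<close>,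
  \<open>R2\<close> and \<open>i\<close>, which misses \<open>Q\<close> and so is short.\<close>

lemma three_exchange:
  assumes "distinct (i # Q @ j # R1 @ R2)" "Q \<noteq> []" "R1 \<noteq> []" "R2 \<noteq> []"
    "n = length (i # Q @ j # R1 @ R2)"
  defines "H \<equiv> cyc_edges (i # Q @ j # R1 @ R2)"
  defines "vs \<equiv> j # R1 @ Q @ R2 @ [i]"
  defines "D \<equiv> {{i, hd Q}, {last Q, j}, {last R1, hd R2}}"
  shows "is_exchange n H (cyc_edges vs) D {i, j} {i, hd Q} {last Q, j} {last R2, i} {j, hd R1}"
    and "card (path_edges vs - H) \<le> 2"
proof -
  define q r s u v p where "q = hd Q" and "r = last Q" and "s = hd R1" and "u = last R1"
    and "v = hd R2" and "p = last R2"
  note qrsp = this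
  have mem: "q \<in> set Q" "r \<in> set Q" "s \<in> set R1" "u \<in> set R1" "v \<in> set R2" "p \<in> set R2"
    using assms by (auto simp: qrsp)
  then have neq: "i \<noteq> j" "q \<noteq> i" "q \<noteq> j" "r \<noteq> i" "r \<noteq> j" "s \<noteq> i" "s \<noteq> j"
    "u \<noteq> i" "u \<noteq> j" "v \<noteq> i" "v \<noteq> j" "p \<noteq> i" "p \<noteq> j"
    "q \<noteq> s" "q \<noteq> u" "q \<noteq> v" "q \<noteq> p" "r \<noteq> s" "r \<noteq> u" "r \<noteq> v" "r \<noteq> p"
    "s \<noteq> v" "s \<noteq> p" "u \<noteq> v" "u \<noteq> p"
    using assms(1) by auto
  note neq = neq neq[symmetric]
  have H: "H = {{i, q}, {r, j}, {j, s}, {u, v}, {p, i}} \<union> path_edges Q \<union> path_edges R1 \<union> path_edges R2"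
    using assms(2-4) by (auto simp: H_def cyc_edges_Cons path_edges_append path_edges_Cons qrsp)
  have P: "path_edges vs = {{j, s}, {u, q}, {r, v}, {p, i}} \<union> path_edges Q \<union> path_edges R1 \<union> path_edges R2"
    using assms(2-4) by (auto simp: vs_def path_edges_append path_edges_Cons qrsp)
  have C: "cyc_edges vs = insert {i, j} (path_edges vs)"
    using assms(2-4) by (simp add: vs_def cyc_edges_conv_path)
  have D: "D = {{i, q}, {r, j}, {u, v}}" by (simp add: D_def qrsp)
  have Q: "e \<in> path_edges Q \<Longrightarrow> i \<notin> e \<and> j \<notin> e \<and> u \<notin> e" for e
    using path_edges_subset[of e Q] assms(1) mem by auto
  have R1: "e \<in> path_edges R1 \<Longrightarrow> i \<notin> e \<and> j \<notin> e \<and> v \<notin> e" for e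
    using path_edges_subset[of e R1] assms(1) mem by auto
  have R2: "e \<in> path_edges R2 \<Longrightarrow> i \<notin> e \<and> j \<notin> e \<and> u \<notin> e" for e
    using path_edges_subset[of e R2] assms(1) mem by auto
  have notin: "{i, y} \<notin> path_edges Q" "{i, y} \<notin> path_edges R1" "{i, y} \<notin> path_edges R2"
     "{y, j} \<notin> path_edges Q" "{y, j} \<notin> path_edges R1" "{y, j} \<notin> path_edges R2"
     "{u, v} \<notin> path_edges Q" "{u, v} \<notin> path_edges R1" "{u, v} \<notin> path_edges R2" for y
    using Q R1 R2 by blast+
  have 1: "H - D \<subseteq> cyc_edges vs" unfolding C P H D by auto
  have 2: "{i, j} \<in> cyc_edges vs - H" unfolding C P H using notin neq
    by (simp add: doubleton_eq_iff)
  have 3: "D \<subseteq> H" unfolding D H by auto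
  have 4: "D \<inter> cyc_edges vs = {}" unfolding D C P using notin neq
    by (simp add: doubleton_eq_iff)
  have 5: "{{p, i}, {j, s}} \<subseteq> H - D" unfolding D H using neq
    by (simp add: doubleton_eq_iff)
  have 6: "{i, q} \<noteq> {r, j}" "{p, i} \<noteq> {j, s}" using neq by (simp_all add: doubleton_eq_iff)
  have 8: "card D \<le> 3" unfolding D by (simp add: card_insert_if)
  have sub: "path_edges R1 \<union> path_edges R2 \<subseteq> H - D"
    unfolding H D using notin by auto
  have cyc: "cyc_edges (j # R1 @ R2 @ [i]) =
    {{j, s}, {u, v}, {p, i}, {i, j}} \<union> path_edges R1 \<union> path_edges R2"
    using assms(2-4) by (auto simp: cyc_edges_Cons path_edges_append path_edges_Cons qrsp)
  have "cyc_edges (j # R1 @ R2 @ [i]) \<subseteq> insert {u, v} (insert {i, j} (H - D))"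
    unfolding cyc using 5 sub by blast
  moreover have "distinct (j # R1 @ R2 @ [i])" "length (j # R1 @ R2 @ [i]) < n"
    "3 \<le> length (j # R1 @ R2 @ [i])"
    using assms(1-5) by (auto simp: Suc_le_eq)
  ultimately have 7: "has_short_cycle n (insert {u, v} (insert {i, j} (H - D)))"
    unfolding has_short_cycle_def by blast
  show "is_exchange n H (cyc_edges vs) D {i, j} {i, hd Q} {last Q, j} {last R2, i} {j, hd R1}"
    unfolding is_exchange_def qrsp[symmetric] using 1 2 3 4 5 6 7 8 by (auto simp: D)
  have "path_edges vs - H \<subseteq> {{u, q}, {r, v}}" unfolding P H by auto
  then have "card (path_edges vs - H) \<le> card {{u, q}, {r, v}}" by (intro card_mono) auto
  then show "card (path_edges vs - H) \<le> 2" by (auto simp: card_insert_if split: if_splits)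
qed

lemma level_exchange:
  assumes "is_exchange n H H' D x d1 d2 e1 e2" "x \<in> opt_edges n" "D \<inter> opt_edges n = {}"
    "is_ham n H" "is_ham n H'"
  shows "level n H < level n H'"
proof -
  have "H \<inter> opt_edges n \<subseteq> H' \<inter> opt_edges n" "x \<in> H' \<inter> opt_edges n" "x \<notin> H"
    using assms unfolding is_exchange_def by auto
  then have "H \<inter> opt_edges n \<subset> H' \<inter> opt_edges n" by blast
  then show ?thesis
    unfolding level_def using is_ham_finite[OF assms(5)] by (intro psubset_card_mono) auto
qed

text \<open>Bundles what the two generators need: the list with at most two edges outside
  \<open>H\<close> is the route of the vertex-based walk, the exchange drives the edge-based
  build.\<close>

definition improving :: "nat \<Rightarrow> sol \<Rightarrow> bool" where
  "improving n H \<longleftrightarrow> (\<exists>vs D x d1 d2 e1 e2. distinct vs \<and> set vs = {1..n} \<and>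
     card (path_edges vs - H) \<le> 2 \<and> is_exchange n H (cyc_edges vs) D x d1 d2 e1 e2 \<and>
     level n H < level n (cyc_edges vs))"

lemma improving_two:
  assumes "distinct (i # Q @ j # R)" "Q \<noteq> []" "R \<noteq> []" "set (i # Q @ j # R) = {1..n}"
    "H = cyc_edges (i # Q @ j # R)" "{i, j} \<in> opt_edges n"
    "{i, hd Q} \<notin> opt_edges n" "{j, hd R} \<notin> opt_edges n"
  shows "improving n H"
proof -
  let ?vs = "j # rev Q @ R @ [i]"
  note ex = two_exchange[OF assms(1-3), folded assms(5)]
  have vs: "distinct ?vs" "set ?vs = {1..n}" using assms by auto
  moreover have "is_ham n H" "is_ham n (cyc_edges ?vs)"
    unfolding is_ham_def using vs assms by blast+
  ultimately show ?thesis
    using level_exchange[OF ex(1)] ex assms unfolding improving_def by blast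
qed

lemma not_three_incident:
  assumes "is_ham n H" "3 \<le> n" "{i, a} \<in> H" "{i, b} \<in> H" "{i, c} \<in> H"
    "a \<noteq> b" "a \<noteq> c" "b \<noteq> c"
  shows False
proof -
  have "{{i, a}, {i, b}, {i, c}} \<subseteq> {e \<in> H. i \<in> e}" using assms by auto
  then have "card {{i, a}, {i, b}, {i, c}} \<le> deg H i"
    unfolding deg_def using is_ham_finite[OF assms(1)] by (intro card_mono) auto
  moreover have "card {{i, a}, {i, b}, {i, c}} = 3"
    using assms(6-8) by (auto simp: doubleton_eq_iff)
  ultimately show False using deg_ham[OF assms(1,2), of i] by (simp split: if_splits)
qed

lemma improving_three:
  assumes "distinct (i # Q @ j # R)" "Q \<noteq> []" "R \<noteq> []" "set (i # Q @ j # R) = {1..n}"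
    "H = cyc_edges (i # Q @ j # R)" "{i, j} \<in> opt_edges n"
    "{last R, i} \<in> opt_edges n" "{j, hd R} \<in> opt_edges n"
  shows "improving n H"
proof -
  have len: "n = length (i # Q @ j # R)"
    using assms(1,4) by (metis card_atLeastAtMost diff_Suc_1 distinct_card)
  with assms(2,3) have n: "4 \<le> n" by (cases Q; cases R) auto
  note S = is_ham_opt_edges[of n]
  have mem: "hd Q \<in> set Q" "last Q \<in> set Q" "hd R \<in> set R" "last R \<in> set R" using assms by auto
  then have neq: "hd Q \<noteq> last R" "last Q \<noteq> hd R" using assms(1) by auto
  \<comment> \<open>The optimal cycle already has two edges at \<open>i\<close>, namely
    \<open>{i, j}\<close> and \<open>{last R, i}\<close>; likewise at \<open>j\<close>
    below.\<close>
  have iq: "{i, hd Q} \<notin> opt_edges n"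
    using not_three_incident[OF S, of i j "last R" "hd Q"] n assms(1,6,7) mem neq
    by (auto simp: insert_commute)
  have jr: "{last Q, j} \<notin> opt_edges n"
    using not_three_incident[OF S, of j i "hd R" "last Q"] n assms(1,6,8) mem neq
    by (auto simp: insert_commute)
  \<comment> \<open>Otherwise \<open>R\<close> together with \<open>i\<close> and \<open>j\<close>
    would form a cheap cycle that misses \<open>Q\<close>.\<close>
  have "\<not> path_edges R \<subseteq> opt_edges n"
  proof
    assume "path_edges R \<subseteq> opt_edges n"
    then have "cyc_edges (j # R @ [i]) \<subseteq> opt_edges n"
      using assms by (auto simp: cyc_edges_Cons path_edges_append insert_commute)
    moreover have "distinct (j # R @ [i])" "length (j # R @ [i]) < n" "3 \<le> length (j # R @ [i])"
      using assms(1-3) len by (auto simp: Suc_le_eq)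
    ultimately have "has_short_cycle n (opt_edges n)"
      unfolding has_short_cycle_def by blast
    then show False using ham_no_short_cycle[OF S] n by simp
  qed
  then obtain e where "e \<in> path_edges R" "e \<notin> opt_edges n" by blast
  then obtain R1 R2 where R: "R = R1 @ R2" "R1 \<noteq> []" "R2 \<noteq> []" "{last R1, hd R2} \<notin> opt_edges n"
    using path_edges_split by metis
  let ?vs = "j # R1 @ Q @ R2 @ [i]"
  have ex: "is_exchange n H (cyc_edges ?vs) {{i, hd Q}, {last Q, j}, {last R1, hd R2}}
      {i, j} {i, hd Q} {last Q, j} {last R2, i} {j, hd R1}"
    "card (path_edges ?vs - H) \<le> 2"
    using three_exchange[of i Q j R1 R2 n] assms R len by auto
  have vs: "distinct ?vs" "set ?vs = {1..n}" using assms(1,4) R by auto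
  moreover have "is_ham n H" "is_ham n (cyc_edges ?vs)"
    unfolding is_ham_def using vs assms by blast+
  ultimately show ?thesis
    using level_exchange[OF ex(1)] ex assms iq jr R unfolding improving_def by blast
qed

lemma improving_nonopt:
  assumes "is_ham n H" "3 \<le> n" "level n H < n"
  shows "improving n H"
proof -
  note S = is_ham_opt_edges[of n]
  have "\<not> opt_edges n \<subseteq> H"
    using assms is_ham_card[OF S] by (auto simp: level_def Int_absorb1)
  then obtain x where x: "x \<in> opt_edges n" "x \<notin> H" by blast
  have "x \<in> kn_edges n" using is_ham_kn[OF S] assms(2) x(1) by auto
  then obtain i j where ij: "x = {i, j}" "i \<noteq> j" "i \<in> {1..n}" "j \<in> {1..n}"
    unfolding kn_edges_def by blast
  obtain ws where ws: "distinct (i # ws)" "set (i # ws) = {1..n}" "H = cyc_edges (i # ws)"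
    using is_ham_rotate[OF assms(1) ij(3)] .
  then have "j \<in> set ws" using ij by auto
  then obtain Q R where QR: "ws = Q @ j # R" by (meson split_list)
  have Q: "Q \<noteq> []" and R: "R \<noteq> []"
    using x ws QR ij by (auto simp: cyc_edges_Cons)
  \<comment> \<open>Reading the same cycle backwards from \<open>i\<close> exchanges the roles of
    \<open>Q\<close> and \<open>R\<close>, so both criteria are available on either side.\<close>
  let ?l = "i # Q @ j # R" and ?l' = "i # rev R @ j # rev Q"
  have l: "distinct ?l" "set ?l = {1..n}" "H = cyc_edges ?l" using ws QR by auto
  have "cyc_edges ?l' = cyc_edges (rev ?l)"
    using cyc_edges_swap[of "[i]" "rev R @ j # rev Q"] by simp
  then have l': "distinct ?l'" "set ?l' = {1..n}" "H = cyc_edges ?l'"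
    using l cyc_edges_rev[of ?l] by auto
  note two = improving_two[OF l(1) Q R l(2,3)]
    improving_two[OF l'(1) _ _ l'(2,3), simplified hd_rev last_rev]
  note three = improving_three[OF l(1) Q R l(2,3)]
    improving_three[OF l'(1) _ _ l'(2,3), simplified hd_rev last_rev]
  have mem: "hd Q \<in> set Q" "last Q \<in> set Q" "hd R \<in> set R" "last R \<in> set R" using Q R by auto
  then have neq: "hd Q \<noteq> last R" "last Q \<noteq> hd R" using l(1) by auto
  \<comment> \<open>The edge \<open>x\<close> is cheap, so at \<open>i\<close>, and likewise at
    \<open>j\<close>, at most one of the two edges of \<open>H\<close> is cheap. Either an expensive
    pair fits a 2-exchange in one of the readings, or the cheap edges at \<open>i\<close> and
    \<open>j\<close> both lead into \<open>R\<close> or both into \<open>Q\<close>, which is the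
    case of a 3-exchange.\<close>
  have i: "\<not> ({i, hd Q} \<in> opt_edges n \<and> {i, last R} \<in> opt_edges n)"
    using not_three_incident[OF S assms(2), of i j "last R" "hd Q"] l(1) x ij mem neq by auto
  have j: "\<not> ({j, last Q} \<in> opt_edges n \<and> {j, hd R} \<in> opt_edges n)"
    using not_three_incident[OF S assms(2), of j i "hd R" "last Q"] l(1) x ij mem neq
    by (auto simp: insert_commute)
  show ?thesis
    using two three i j x ij Q R by (auto simp: insert_commute)
qed

section \<open>Extending partial solutions to Hamiltonian cycles\<close>

text \<open>A linear forest, each component given by one of its two readings. Isolated vertices are
  singleton lists, so the components cover \<open>{1..n}\<close>.\<close>

definition path_system :: "nat \<Rightarrow> nat list set \<Rightarrow> sol \<Rightarrow> bool" where
  "path_system n F B \<longleftrightarrow> finite F \<and> (\<forall>p\<in>F. p \<noteq> [] \<and> distinct p) \<and>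
     (\<forall>p\<in>F. \<forall>q\<in>F. p \<noteq> q \<longrightarrow> set p \<inter> set q = {}) \<and>
     \<Union>(set ` F) = {1..n} \<and> B = \<Union>(path_edges ` F)"

lemma path_systemD:
  assumes "path_system n F B"
  shows "finite F" "p \<in> F \<Longrightarrow> p \<noteq> []" "p \<in> F \<Longrightarrow> distinct p"
    "p \<in> F \<Longrightarrow> q \<in> F \<Longrightarrow> p \<noteq> q \<Longrightarrow> set p \<inter> set q = {}"
    "\<Union>(set ` F) = {1..n}" "B = \<Union>(path_edges ` F)"
  using assms by (simp_all add: path_system_def)

lemma path_edges_concat:
  "[] \<notin> set ps \<Longrightarrow> p \<in> set ps \<Longrightarrow> path_edges p \<subseteq> path_edges (concat ps)"
proof (induction ps)
  case (Cons q ps)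
  show ?case
  proof (cases "concat ps = []")
    case True
    then have "ps = []" using Cons.prems by (cases ps) auto
    then show ?thesis using Cons.prems by simp
  next
    case False
    moreover have "q \<noteq> []" using Cons.prems by auto
    ultimately have "path_edges (concat (q # ps)) = insert {last q, hd (concat ps)} (path_edges q \<union> path_edges (concat ps))"
      by (simp add: path_edges_append del: concat_eq_Nil_conv)
    then show ?thesis using Cons by auto
  qed
qed auto

text \<open>The paths can be chained end to end in any order and closed up, since the graph is
  complete.\<close>

lemma path_system_ham:
  assumes "path_system n F B" "1 \<le> n"
  obtains H where "is_ham n H" "B \<subseteq> H"
proof -
  obtain ps where ps: "set ps = F" "distinct ps"
    using finite_distinct_list[OF path_systemD(1)[OF assms(1)]] by blast
  note F = path_systemD[OF assms(1), folded ps(1)]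
  have d: "distinct (concat ps)"
    by (intro distinct_concat ps(2) F)
  have s: "set (concat ps) = {1..n}"
    using F(5) by simp
  have ne: "[] \<notin> set ps" using F(2) by blast
  have "1 \<in> set (concat ps)" unfolding s using assms(2) by simp
  then have "concat ps \<noteq> []" by (metis empty_iff empty_set)
  moreover have "B \<subseteq> path_edges (concat ps)"
    unfolding F(6) using path_edges_concat[OF ne] by blast
  ultimately have "B \<subseteq> cyc_edges (concat ps)" by (auto simp: cyc_edges_conv_path)
  moreover have "is_ham n (cyc_edges (concat ps))" unfolding is_ham_def using d s by blast
  ultimately show thesis using that by blast
qed

lemma path_system_rev:
  assumes "path_system n F B" "p \<in> F"
  shows "path_system n (insert (rev p) (F - {p})) B"
proof -
  have fin: "finite F" and ne: "\<forall>p\<in>F. p \<noteq> [] \<and> distinct p"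
    and disj: "\<forall>p\<in>F. \<forall>q\<in>F. p \<noteq> q \<longrightarrow> set p \<inter> set q = {}"
    and un: "\<Union>(set ` F) = {1..n}" "B = \<Union>(path_edges ` F)"
    using assms(1) by (simp_all add: path_system_def)
  have "set (rev p) = set p" "path_edges (rev p) = path_edges p" by simp_all
  moreover have "F = insert p (F - {p})" using assms by blast
  ultimately have "\<Union>(set ` insert (rev p) (F - {p})) = \<Union>(set ` F)"
    "\<Union>(path_edges ` insert (rev p) (F - {p})) = \<Union>(path_edges ` F)"
    by (metis (no_types, lifting) Union_insert image_insert)+
  moreover have "\<forall>q\<in>F - {p}. set p \<inter> set q = {}" "p \<noteq> []" "distinct p" "finite F"
    "\<forall>q\<in>F - {p}. \<forall>r\<in>F - {p}. q \<noteq> r \<longrightarrow> set q \<inter> set r = {}"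
    "\<forall>q\<in>F - {p}. q \<noteq> [] \<and> distinct q" "\<Union>(set ` F) = {1..n}" "B = \<Union>(path_edges ` F)"
    using fin ne disj un assms(2-) by blast+
  ultimately show ?thesis
    unfolding path_system_def by (simp add: Int_commute)
qed

lemma path_system_join:
  assumes "path_system n F B" "p \<in> F" "q \<in> F" "p \<noteq> q"
  shows "path_system n (insert (p @ q) (F - {p, q})) (insert {last p, hd q} B)"
proof -
  have fin: "finite F" and ne: "\<forall>p\<in>F. p \<noteq> [] \<and> distinct p"
    and disj: "\<forall>p\<in>F. \<forall>q\<in>F. p \<noteq> q \<longrightarrow> set p \<inter> set q = {}"
    and un: "\<Union>(set ` F) = {1..n}" "B = \<Union>(path_edges ` F)"
    using assms(1) by (simp_all add: path_system_def)
  have F: "F = insert p (insert q (F - {p, q}))" using assms by blast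
  have "\<Union>(set ` F) = set p \<union> set q \<union> \<Union>(set ` (F - {p, q}))"
    "\<Union>(path_edges ` F) = path_edges p \<union> path_edges q \<union> \<Union>(path_edges ` (F - {p, q}))"
    by (subst F, blast)+
  moreover have "p \<noteq> []" "q \<noteq> []" "distinct p" "distinct q" "set p \<inter> set q = {}" "finite F"
    "\<forall>r\<in>F - {p, q}. set p \<inter> set r = {} \<and> set q \<inter> set r = {}"
    "\<forall>r\<in>F - {p, q}. \<forall>r'\<in>F - {p, q}. r \<noteq> r' \<longrightarrow> set r \<inter> set r' = {}"
    "\<forall>r\<in>F - {p, q}. r \<noteq> [] \<and> distinct r" "\<Union>(set ` F) = {1..n}" "B = \<Union>(path_edges ` F)"
    using fin ne disj un assms(2-) by blast+
  ultimately show ?thesis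
    unfolding path_system_def
    by (simp add: path_edges_append Int_commute Int_Un_distrib Int_Un_distrib2)
qed

lemma path_edges_inner_deg:
  assumes "distinct p" "v \<in> set p" "v \<noteq> hd p" "v \<noteq> last p"
  obtains a b where "{v, a} \<in> path_edges p" "{v, b} \<in> path_edges p" "a \<noteq> b"
proof -
  obtain xs ys where p: "p = xs @ v # ys" using assms(2) by (meson split_list)
  then have ne: "xs \<noteq> []" "ys \<noteq> []" using assms by auto
  show thesis
  proof (rule that[of "last xs" "hd ys"])
    show "last xs \<noteq> hd ys" using p ne assms(1) by (metis disjoint_iff distinct.simps(2) distinct_append hd_in_set last_in_set list.set_intros(2))
  qed (use p ne in \<open>auto simp: path_edges_append path_edges_Cons insert_commute\<close>)
qed

text \<open>An inner vertex of a path already has degree 2 and cannot take another edge.\<close>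

lemma admissible_endpoint:
  assumes "path_system n F B" "{a, b} \<in> admissible n B" "a \<in> set p" "p \<in> F"
  shows "a = hd p \<or> a = last p"
proof (rule ccontr)
  assume "\<not> ?thesis"
  then obtain c d where cd: "{a, c} \<in> path_edges p" "{a, d} \<in> path_edges p" "c \<noteq> d"
    using path_edges_inner_deg[OF path_systemD(3)[OF assms(1,4)] assms(3)] by metis
  note B = path_systemD(6,1)[OF assms(1)]
  then have fin: "finite (insert {a, b} B)" by auto
  have "{a, c} \<in> B" "{a, d} \<in> B" using cd assms(4) B by auto
  moreover have "{a, b} \<notin> B" using assms(2) unfolding admissible_def by blast
  ultimately have "b \<noteq> c" "b \<noteq> d" by auto
  have "card {{a, b}, {a, c}, {a, d}} \<le> deg (insert {a, b} B) a"
    unfolding deg_def using fin \<open>{a, c} \<in> B\<close> \<open>{a, d} \<in> B\<close> by (intro card_mono) auto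
  moreover have "card {{a, b}, {a, c}, {a, d}} = 3"
    using cd \<open>b \<noteq> c\<close> \<open>b \<noteq> d\<close> by (auto simp: doubleton_eq_iff)
  moreover have "deg (insert {a, b} B) a < 3" using assms(2) unfolding admissible_def by blast
  ultimately show False by simp
qed

text \<open>Reversal turns the wanted endpoint into the last one. The equation on the remaining
  paths allows two different paths to be normalised one after the other.\<close>

lemma path_system_last:
  assumes "path_system n F B" "p \<in> F" "a = hd p \<or> a = last p"
  obtains F' p' where "path_system n F' B" "p' \<in> F'" "last p' = a" "set p' = set p" "F' - {p'} = F - {p}"
proof (cases "a = last p")
  case True
  then show thesis using that[of F p] assms by auto
next
  case False
  then have "last (rev p) = a" using assms by (auto simp: last_rev)
  moreover have "rev p \<notin> F - {p}"
  proof
    assume "rev p \<in> F - {p}"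
    then have "rev p \<in> F" "rev p \<noteq> p" by auto
    then have "set (rev p) \<inter> set p = {}" "p \<noteq> []" using path_systemD[OF assms(1)] assms(2) by metis+
    then show False by simp
  qed
  then have "insert (rev p) (F - {p}) - {rev p} = F - {p}" by auto
  ultimately show thesis using that[OF path_system_rev[OF assms(1,2)], of "rev p"] by auto
qed

text \<open>An admissible edge joins endpoints. Between two paths it merges them; within one path it
  closes a cycle, which must pass through all \<open>n\<close> vertices because it may not be
  short.\<close>

lemma path_system_step:
  assumes "path_system n F B" "e \<in> admissible n B" "3 \<le> n"
  shows "is_ham n (insert e B) \<or> (\<exists>F'. path_system n F' (insert e B))"
proof -
  from assms(2) obtain a b where e: "e = {a, b}" "a \<in> {1..n}" "b \<in> {1..n}" "a \<noteq> b"
    unfolding admissible_def kn_edges_def by blast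
  note F = path_systemD[OF assms(1)]
  have U: "\<Union>(set ` F) = {1..n}" by (fact F(5))
  then obtain p q where p: "p \<in> F" "a \<in> set p" and q: "q \<in> F" "b \<in> set q"
    using e by (metis (no_types, lifting) UN_E)
  have a: "a = hd p \<or> a = last p" using admissible_endpoint assms e p by blast
  have b: "b = hd q \<or> b = last q" using admissible_endpoint assms e q by (metis insert_commute)
  show ?thesis
  proof (cases "p = q")
    case False
    from path_system_last[OF assms(1) p(1) a] obtain F1 p1 where 1: "path_system n F1 B"
      "p1 \<in> F1" "last p1 = a" "set p1 = set p" "F1 - {p1} = F - {p}" .
    have q1: "q \<in> F1" "p1 \<noteq> q" using 1(5) q False by auto
    from path_system_last[OF 1(1) q1(1) b] obtain F2 q2 where 2: "path_system n F2 B"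
      "q2 \<in> F2" "last q2 = b" "set q2 = set q" "F2 - {q2} = F1 - {q}" .
    have p2: "p1 \<in> F2" "p1 \<noteq> q2" using 2(5) 1(2) q1 by auto
    let ?F3 = "insert (rev q2) (F2 - {q2})"
    have 3: "path_system n ?F3 B" using path_system_rev 2 by blast
    have "set p1 \<inter> set q2 = {}" using path_systemD(4)[OF 2(1)] 2(2) p2 by blast
    then have "p1 \<noteq> rev q2" using 1(4) p by auto
    then have "path_system n (insert (p1 @ rev q2) (?F3 - {p1, rev q2})) (insert {last p1, hd (rev q2)} B)"
      by (intro path_system_join 3) (use p2 in auto)
    moreover have "{last p1, hd (rev q2)} = e" using 1 2 e by (simp add: hd_rev)
    ultimately show ?thesis by auto
  next
    case True
    then have ab: "e = {last p, hd p}" "hd p \<noteq> last p" using a b e by auto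
    have pp: "p \<noteq> []" "distinct p" "B = \<Union>(path_edges ` F)" using F p by auto
    have sub: "path_edges p \<subseteq> B" using pp p by auto
    have cyc: "cyc_edges p \<subseteq> insert e B" using pp ab sub by (auto simp: cyc_edges_conv_path)
    have "e \<notin> B" "\<not> has_short_cycle n (insert e B)" using assms(2) unfolding admissible_def by auto
    \<comment> \<open>\<open>has_short_cycle\<close> speaks of length at least 3 only; on a path of
      two vertices the closing edge would already be in \<open>B\<close>.\<close>
    have "length p \<noteq> 2"
    proof
      assume "length p = 2"
      then obtain c d where "p = [c, d]" by (auto simp: numeral_2_eq_2 length_Suc_conv)
      then show False using sub ab \<open>e \<notin> B\<close> by (auto simp: insert_commute)
    qed
    moreover have "length p \<noteq> 0" "length p \<noteq> 1" using ab(2) pp(1) by (auto simp: length_Suc_conv)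
    ultimately have "3 \<le> length p" by linarith
    then have "\<not> length p < n"
      using cyc \<open>\<not> has_short_cycle n (insert e B)\<close> pp(2) unfolding has_short_cycle_def by blast
    moreover have "set p \<subseteq> {1..n}" using U p by auto
    moreover have "card (set p) = length p" using pp distinct_card by blast
    ultimately have sp: "set p = {1..n}" by (intro card_seteq) auto
    have "F = {p}"
    proof -
      have "r = p" if "r \<in> F" for r
      proof (rule ccontr)
        assume "r \<noteq> p"
        then have "set r \<inter> set p = {}" "r \<noteq> []" "set r \<subseteq> {1..n}"
          using that p F(4)[of r p] F(2)[of r] U by auto
        then have "set r = {}" unfolding sp by (simp add: Int_absorb2)
        then show False using \<open>r \<noteq> []\<close> by simp
      qed
      then show ?thesis using p(1) by blast
    qed
    then have "insert e B = cyc_edges p" using pp ab by (simp add: cyc_edges_conv_path)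
    then have "is_ham n (insert e B)" using sp pp(2) unfolding is_ham_def by blast
    then show ?thesis ..
  qed
qed

lemma path_system_empty: "path_system n ((\<lambda>v. [v]) ` {1..n}) {}"
  unfolding path_system_def by auto

section \<open>Vertex-based generation\<close>

text \<open>\<open>embed_pmf\<close> has the prescribed masses only if they are nonnegative and sum
  to 1, hence the positive total weight.\<close>

lemma pmf_weighted_pmf:
  assumes "finite A" "\<And>x. x \<in> A \<Longrightarrow> 0 \<le> w x" "0 < sum w A"
  shows "pmf (weighted_pmf w A) x = (if x \<in> A then w x / sum w A else 0)"
  unfolding weighted_pmf_def
proof (rule pmf_embed_pmf)
  show "0 \<le> (if x \<in> A then w x / sum w A else 0)" for x
    using assms by auto
  have "(\<integral>\<^sup>+x. ennreal (if x \<in> A then w x / sum w A else 0) \<partial>count_space UNIV)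
      = (\<Sum>x\<in>A. ennreal (if x \<in> A then w x / sum w A else 0))"
    using assms by (intro nn_integral_count_space') auto
  also have "\<dots> = ennreal (\<Sum>x\<in>A. w x / sum w A)"
    using assms by (subst sum_ennreal[symmetric]) auto
  also have "(\<Sum>x\<in>A. w x / sum w A) = 1"
    using assms(3) by (simp flip: sum_divide_distrib)
  finally show "(\<integral>\<^sup>+x. ennreal (if x \<in> A then w x / sum w A else 0) \<partial>count_space UNIV) = 1"
    by simp
qed

lemma set_weighted_pmf:
  assumes "finite A" "A \<noteq> {}" "\<And>x. x \<in> A \<Longrightarrow> 0 < w x"
  shows "set_pmf (weighted_pmf w A) \<subseteq> A"
proof -
  have "0 < sum w A" using assms by (intro sum_pos) auto
  then show ?thesis
    using assms by (auto simp: set_pmf_iff pmf_weighted_pmf less_imp_le split: if_splits)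
qed

lemma integrable_pmf_bounded:
  fixes g :: "'a \<Rightarrow> real"
  assumes "\<And>x. 0 \<le> g x" "\<And>x. g x \<le> c"
  shows "integrable (measure_pmf p) g"
  using assms by (intro measure_pmf.integrable_const_bound[where B = c]) simp_all

text \<open>Only some outcomes of the first draw are kept. The lower bounds on both generators rest
  on this: one outcome per step for a fixed walk, a sum over the favourable edges for the edge-based
  build.\<close>

lemma pmf_bind_ge_sum:
  assumes "finite G"
  shows "(\<Sum>x\<in>G. pmf p x * pmf (f x) y) \<le> pmf (bind_pmf p f) y"
proof -
  have "(\<Sum>x\<in>G. pmf p x * pmf (f x) y) = (\<integral>x. indicator G x * pmf (f x) y \<partial>measure_pmf p)"
    using assms by (subst integral_measure_pmf_real[of G]) (auto simp: indicator_def mult.commute split: if_splits)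
  also have "\<dots> \<le> (\<integral>x. pmf (f x) y \<partial>measure_pmf p)"
    by (intro integral_mono integrable_pmf_bounded[where c = 1])
       (auto split: split_indicator simp: pmf_le_1)
  finally show ?thesis by (simp add: pmf_bind)
qed

lemma pmf_map_ge: "pmf p x \<le> pmf (map_pmf f p) (f x)"
  unfolding pmf_map using measure_pmf.finite_measure_mono[of "{x}" "f -` {f x}" p]
  by (simp add: measure_pmf_single)

section \<open>Normalising sums of the vertex-based walk\<close>

lemma pi_min_pos: "3 \<le> n \<Longrightarrow> 0 < pi_min n"
  by (simp add: pi_min_def)

lemma pi_max_pos: "3 \<le> n \<Longrightarrow> 0 < pi_max n"
  by (simp add: pi_max_def)

lemma pi_of_pos: "3 \<le> n \<Longrightarrow> i \<noteq> j \<Longrightarrow> 0 < pi_of n H i j"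
  by (simp add: pi_of_def pi_min_pos pi_max_pos)

lemma pi0_pos: "3 \<le> n \<Longrightarrow> i \<noteq> j \<Longrightarrow> 0 < pi0 n i j"
  by (simp add: pi0_def)

lemma ham_neighbours:
  assumes "is_ham n H" "3 \<le> n"
  shows "finite {u. {v, u} \<in> H}" "card {u. {v, u} \<in> H} \<le> 2"
proof -
  have fin: "finite {e \<in> H. v \<in> e}" using is_ham_finite[OF assms(1)] by simp
  have inj: "inj_on (\<lambda>u. {v, u}) {u. {v, u} \<in> H}"
    by (auto simp: inj_on_def doubleton_eq_iff)
  have sub: "(\<lambda>u. {v, u}) ` {u. {v, u} \<in> H} \<subseteq> {e \<in> H. v \<in> e}" by auto
  show "finite {u. {v, u} \<in> H}" using inj_on_finite[OF inj sub fin] .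
  have "card {u. {v, u} \<in> H} \<le> deg H v"
    unfolding deg_def using card_inj_on_le[OF inj sub fin] .
  then show "card {u. {v, u} \<in> H} \<le> 2" using deg_ham[OF assms, of v] by (simp split: if_splits)
qed

lemma sum_pi_of:
  assumes "finite U" "v \<notin> U"
  shows "sum (pi_of n H v) U = real (card {u \<in> U. {v, u} \<in> H}) * pi_max n
           + real (card {u \<in> U. {v, u} \<notin> H}) * pi_min n"
proof -
  have "sum (pi_of n H v) U = (\<Sum>u\<in>U. if {v, u} \<in> H then pi_max n else pi_min n)"
    using assms by (intro sum.cong) (auto simp: pi_of_def)
  also have "\<dots> = (\<Sum>u\<in>{u \<in> U. {v, u} \<in> H}. pi_max n) + (\<Sum>u\<in>{u \<in> U. {v, u} \<notin> H}. pi_min n)"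
    using assms(1) by (simp add: sum.If_cases Int_def Collect_neg_eq[symmetric])
  finally show ?thesis by simp
qed

text \<open>At most two heavy edges and at most \<open>n\<close> light ones, the latter of total
  weight at most \<open>1 / (n - 2)\<close>. This crude bound is charged only at the start and after
  an edge outside \<open>H\<close>.\<close>

lemma sum_pi_of_le_3:
  assumes "is_ham n H" "3 \<le> n" "U \<subseteq> {1..n} - {v}" "v \<in> {1..n}"
  shows "sum (pi_of n H v) U \<le> 3"
proof -
  have fin: "finite U" using assms(3) by (rule finite_subset) simp
  have "card {u \<in> U. {v, u} \<in> H} \<le> card {u. {v, u} \<in> H}"
    using ham_neighbours[OF assms(1,2)] by (intro card_mono) auto
  then have 1: "card {u \<in> U. {v, u} \<in> H} \<le> 2" using ham_neighbours[OF assms(1,2), of v] by simp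
  have "card {u \<in> U. {v, u} \<notin> H} \<le> card {1..n}" using assms(3) by (intro card_mono) auto
  then have 2: "card {u \<in> U. {v, u} \<notin> H} \<le> n" by simp
  have "real (card {u \<in> U. {v, u} \<in> H}) * pi_max n \<le> 2 * 1"
    using 1 pi_max_pos[OF assms(2)] by (intro mult_mono) (auto simp: pi_max_def)
  moreover have "real (card {u \<in> U. {v, u} \<notin> H}) * pi_min n \<le> real n * pi_min n"
    using 2 pi_min_pos[OF assms(2)] by (intro mult_right_mono) auto
  moreover have "v \<notin> U" using assms(3) by blast
  ultimately have "sum (pi_of n H v) U \<le> 2 * 1 + real n * pi_min n"
    using fin by (simp add: sum_pi_of)
  also have "real n * pi_min n \<le> 1" using assms(2) by (simp add: pi_min_def)
  finally show ?thesis by simp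
qed

text \<open>This serves almost every step, so a fixed constant above 1 would accumulate
  exponentially; \<open>pi_max n + (n - 2) * pi_min n = 1\<close> gives exactly 1.\<close>

lemma sum_pi_of_le_1:
  assumes "3 \<le> n" "finite U" "v \<notin> U" "card U + 2 \<le> n" "card {u \<in> U. {v, u} \<in> H} \<le> 1"
  shows "sum (pi_of n H v) U \<le> 1"
proof -
  have "card {u \<in> U. {v, u} \<notin> H} \<le> card U" using assms by (intro card_mono) auto
  then have "real (card {u \<in> U. {v, u} \<notin> H}) \<le> real n - 2" using assms by linarith
  then have "sum (pi_of n H v) U \<le> 1 * pi_max n + (real n - 2) * pi_min n"
    using assms pi_min_pos[of n] pi_max_pos[of n]
    by (subst sum_pi_of) (auto intro!: add_mono mult_right_mono)
  also have "\<dots> = 1" using assms(1) by (simp add: pi_min_def pi_max_def field_simps)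
  finally show ?thesis .
qed

lemma pmf_vwalk_Cons_ge:
  "pmf (weighted_pmf (P v) U) v' * pmf (vwalk k P (U - {v'}) v') vs
     \<le> pmf (vwalk (Suc k) P U v) (v' # vs)"
  using pmf_bind_ge_sum[of "{v'}" "weighted_pmf (P v) U"
      "\<lambda>v'. map_pmf ((#) v') (vwalk k P (U - {v'}) v')" "v' # vs"]
  by (simp add: pmf_map_inj')

text \<open>The flag \<open>fresh\<close> is false when the walk entered \<open>v\<close> along an edge of \<open>H\<close>; then at most one
  \<open>H\<close>-neighbour of \<open>v\<close> is unvisited and the normalising sum is at most 1.\<close>

lemma pmf_vwalk_ge:
  assumes "is_ham n H" "3 \<le> n"
    and "distinct (v # vs)" "set (v # vs) \<subseteq> {1..n}"
    and "\<not> fresh \<Longrightarrow> length vs + 2 \<le> n \<and> card {u \<in> set vs. {v, u} \<in> H} \<le> 1"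
  shows "pi_max n ^ length vs * (if fresh then 1 / 3 else 1)
      * (pi_min n / 9) ^ card (path_edges (v # vs) - H)
    \<le> pmf (vwalk (length vs) (pi_of n H) (set vs) v) vs"
  using assms(3-)
proof (induction vs arbitrary: v fresh)
  case Nil
  then show ?case by simp
next
  case (Cons w vs)
  let ?P = "pi_of n H" and ?U = "set (w # vs)"
  note pos = pi_min_pos[OF assms(2)] pi_max_pos[OF assms(2)]
  have U: "finite ?U" "v \<notin> ?U" "?U \<subseteq> {1..n} - {v}" "v \<in> {1..n}" using Cons.prems by auto
  have P_pos: "0 < ?P v x" if "x \<in> ?U" for x
    using U that by (intro pi_of_pos[OF assms(2)]) blast
  then have sum_pos: "0 < sum (?P v) ?U"
    using U by (intro sum_pos) simp_all
  have "{v, w} \<notin> path_edges (w # vs)" using path_edges_subset[of "{v, w}" "w # vs"] U by auto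
  then have card: "card (path_edges (v # w # vs) - H)
      = card (path_edges (w # vs) - H) + (if {v, w} \<in> H then 0 else 1)"
    by (simp add: insert_Diff_if)
  have first: "pmf (weighted_pmf (?P v) ?U) w = ?P v w / sum (?P v) ?U"
    using U sum_pos P_pos by (subst pmf_weighted_pmf) (simp_all add: less_imp_le)
  have Uw: "?U - {w} = set vs" using Cons.prems(1) by auto
  have IH: "pi_max n ^ length vs * (if {v, w} \<in> H then 1 else 1 / 3)
      * (pi_min n / 9) ^ card (path_edges (w # vs) - H)
    \<le> pmf (vwalk (length vs) ?P (set vs) w) vs"
  proof -
    \<comment> \<open>The vertex \<open>v\<close> is one of the at most two neighbours of
      \<open>w\<close> in \<open>H\<close> and is already visited; \<open>v\<close> and
      \<open>w\<close> account for the \<open>+ 2\<close>.\<close>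
    have "length vs + 2 \<le> n \<and> card {u \<in> set vs. {w, u} \<in> H} \<le> 1" if "{v, w} \<in> H"
    proof
      have "card (set (v # w # vs)) \<le> card {1..n}" using Cons.prems(2) by (intro card_mono) auto
      then show "length vs + 2 \<le> n" using distinct_card[OF Cons.prems(1)] by simp
      have "insert v {u \<in> set vs. {w, u} \<in> H} \<subseteq> {u. {w, u} \<in> H}"
        using that by (auto simp: insert_commute)
      then have "card (insert v {u \<in> set vs. {w, u} \<in> H}) \<le> card {u. {w, u} \<in> H}"
        using ham_neighbours[OF assms(1,2)] by (intro card_mono) auto
      then show "card {u \<in> set vs. {w, u} \<in> H} \<le> 1"
        using ham_neighbours[OF assms(1,2), of w] Cons.prems(1) by auto
    qed
    then show ?thesis
      using Cons.IH[of w "{v, w} \<notin> H"] Cons.prems by (simp split: if_splits)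
  qed
  let ?r = "pi_max n ^ length vs * (pi_min n / 9) ^ card (path_edges (w # vs) - H)"
  have r: "0 \<le> ?r" using pos by auto
  have le: "?P v w * (if fresh then 1 / 3 else 1) \<le> ?P v w / sum (?P v) ?U"
  proof (cases fresh)
    case True
    have "?P v w / 3 \<le> ?P v w / sum (?P v) ?U"
      using sum_pi_of_le_3[OF assms(1,2) U(3,4)] sum_pos P_pos[of w]
      by (intro divide_left_mono) auto
    with True show ?thesis by simp
  next
    case False
    then have "sum (?P v) ?U \<le> 1"
      using Cons.prems U by (intro sum_pi_of_le_1[OF assms(2)]) (auto simp: distinct_card)
    then have "?P v w / 1 \<le> ?P v w / sum (?P v) ?U"
      using sum_pos P_pos[of w] by (intro divide_left_mono) auto
    with False show ?thesis by simp
  qed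
  \<comment> \<open>A step outside \<open>H\<close> leaves \<open>w\<close> fresh and so costs
    \<open>pi_min n\<close> and a further \<open>1 / 3\<close>; both fit into
    \<open>pi_min n / 9\<close>. The power of \<open>pi_max n\<close> counts all steps, which is
    safe as \<open>pi_max n \<le> 1\<close>.\<close>
  have eq: "pi_max n ^ length (w # vs) * (if fresh then 1 / 3 else 1)
      * (pi_min n / 9) ^ card (path_edges (v # w # vs) - H)
    \<le> (?P v w * (if fresh then 1 / 3 else 1)) * (?r * (if {v, w} \<in> H then 1 else 1 / 3))"
  proof (cases "{v, w} \<in> H")
    case True
    then have "?P v w = pi_max n" using U by (auto simp: pi_of_def)
    with True show ?thesis unfolding card by simp
  next
    case False
    then have P: "?P v w = pi_min n" using U by (auto simp: pi_of_def)
    have "pi_max n \<le> 1" by (simp add: pi_max_def)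
    then have "pi_max n * (?r * ((if fresh then 1 / 3 else 1) * (pi_min n / 9))) \<le>
      1 * (?r * ((if fresh then 1 / 3 else 1) * (pi_min n / 9)))"
      using pos r by (intro mult_right_mono) auto
    also have "\<dots> \<le> (?P v w * (if fresh then 1 / 3 else 1)) * (?r * (1 / 3))"
      unfolding P using pos r by (auto simp: mult_ac)
    finally show ?thesis unfolding card using False by (simp add: mult_ac)
  qed
  also have "\<dots> \<le> (?P v w / sum (?P v) ?U) * pmf (vwalk (length vs) ?P (set vs) w) vs"
    using le IH r P_pos[of w] sum_pos
    by (intro mult_mono) (auto simp: mult_ac)
  also have "\<dots> \<le> pmf (vwalk (length (w # vs)) ?P ?U v) (w # vs)"
    using pmf_vwalk_Cons_ge[of ?P v ?U w "length vs" vs] unfolding first Uw by simp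
  finally show ?case .
qed

lemma pmf_vertex_gen_ge:
  assumes "distinct (v # vs)" "set (v # vs) = {1..n}"
  shows "pmf (vwalk (length vs) P (set vs) v) vs / real n \<le> pmf (vertex_gen n P) (cyc_edges (v # vs))"
proof -
  have len: "length vs = n - 1" using assms by (metis card_atLeastAtMost diff_Suc_1 distinct_card length_Cons)
  have U: "{1..n} - {v} = set vs" using assms by auto
  have v: "v \<in> {1..n}" using assms by auto
  have "pmf (pmf_of_set {1..n}) v * pmf (vwalk (length vs) P (set vs) v) vs
    \<le> pmf (pmf_of_set {1..n}) v *
       pmf (map_pmf (\<lambda>vs. cyc_edges (v # vs)) (vwalk (n - 1) P ({1..n} - {v}) v)) (cyc_edges (v # vs))"
    unfolding U len[symmetric]
    using pmf_map_ge[of _ vs "\<lambda>vs. cyc_edges (v # vs)"] by (intro mult_left_mono) auto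
  also have "\<dots> \<le> pmf (vertex_gen n P) (cyc_edges (v # vs))"
    unfolding vertex_gen_def using pmf_bind_ge_sum[of "{v}"] by simp
  finally show ?thesis using v by (simp add: field_simps)
qed

text \<open>\<open>1 / pi_max n = 1 + 1 / (n - 1)\<close>, and
  \<open>(1 + 1 / k) ^ k \<le> exp 1\<close>.\<close>

lemma pi_max_power_ge:
  assumes "2 \<le> n"
  shows "exp (- 1) \<le> pi_max n ^ (n - 1)"
proof -
  have "exp (- 1) = inverse (exp (1 / real (n - 1)) ^ (n - 1))"
    using assms by (simp add: exp_minus exp_of_nat_mult[symmetric])
  also have "\<dots> \<le> inverse ((1 + 1 / real (n - 1)) ^ (n - 1))"
    by (intro le_imp_inverse_le power_mono exp_ge_add_one_self zero_less_power add_nonneg_nonneg)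
       (auto intro: add_pos_nonneg)
  also have "\<dots> = pi_max n ^ (n - 1)"
    using assms by (simp add: power_inverse[symmetric] pi_max_def of_nat_diff field_simps)
  finally show ?thesis .
qed

lemma pi_min_ge: "3 \<le> n \<Longrightarrow> 1 / real n ^ 2 \<le> pi_min n"
  unfolding pi_min_def power2_eq_square by (intro divide_left_mono mult_left_mono) auto

lemma vertex_gen_improving:
  assumes "is_ham n H" "3 \<le> n" "improving n H"
  shows "\<exists>H'. is_ham n H' \<and> level n H < level n H' \<and>
    exp (- 1) / 243 / real n ^ 5 \<le> pmf (vertex_gen n (pi_of n H)) H'"
proof -
  from assms(3) obtain us where us: "distinct us" "set us = {1..n}"
    "card (path_edges us - H) \<le> 2" "level n H < level n (cyc_edges us)"
    unfolding improving_def by blast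
  then obtain v vs where vs: "us = v # vs" using assms(2) by (cases us) auto
  have len: "length vs = n - 1" using us vs by (metis card_atLeastAtMost diff_Suc_1 distinct_card length_Cons)
  \<comment> \<open>\<open>243 = 3 * 9 ^ 2\<close>: the fresh start and two edges outside
    \<open>H\<close>. Fewer such edges only help, since \<open>pi_min n / 9 \<le> 1\<close>.\<close>
  have "exp (- 1) / 243 / real n ^ 5 = exp (- 1) * (1 / 3) * (1 / real n ^ 2 / 9) ^ 2 / real n"
    by (simp add: field_simps eval_nat_numeral)
  also have "\<dots> \<le> pi_max n ^ (n - 1) * (1 / 3) * (pi_min n / 9) ^ 2 / real n"
    using assms(2) pi_max_power_ge[of n] pi_min_ge[of n] pi_max_pos[of n]
    by (intro divide_right_mono mult_mono power_mono) auto
  also have "\<dots> \<le> pi_max n ^ (n - 1) * (1 / 3) * (pi_min n / 9) ^ card (path_edges us - H) / real n"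
  proof -
    have "pi_min n \<le> 1 / real n" unfolding pi_min_def using assms(2) by (intro divide_left_mono) auto
    also have "\<dots> \<le> 1" using assms(2) by simp
    finally show ?thesis using us(3) pi_min_pos[OF assms(2)] pi_max_pos[OF assms(2)]
      by (intro divide_right_mono mult_left_mono power_decreasing) auto
  qed
  also have "\<dots> \<le> pmf (vwalk (length vs) (pi_of n H) (set vs) v) vs / real n"
  proof -
    have "set (v # vs) \<subseteq> {1..n}" using us(2) unfolding vs by (rule equalityD1)
    then show ?thesis
      using pmf_vwalk_ge[OF assms(1,2), of v vs True] us(1) unfolding vs len
      by (intro divide_right_mono) simp_all
  qed
  also have "\<dots> \<le> pmf (vertex_gen n (pi_of n H)) (cyc_edges us)"
    using us(1,2) unfolding vs by (rule pmf_vertex_gen_ge)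
  finally show ?thesis using us unfolding is_ham_def by blast
qed

section \<open>Support of the vertex-based generation\<close>

lemma set_vwalk:
  assumes "\<And>i j. i \<noteq> j \<Longrightarrow> 0 < P i j" "finite U" "card U = k" "v \<notin> U" "vs \<in> set_pmf (vwalk k P U v)"
  shows "distinct vs \<and> set vs = U"
  using assms(2-)
proof (induction k arbitrary: U v vs)
  case (Suc k)
  have "set_pmf (weighted_pmf (P v) U) \<subseteq> U"
  proof (rule set_weighted_pmf)
    show "0 < P v x" if "x \<in> U" for x using assms(1)[of v x] Suc.prems(3) that by blast
  qed (use Suc.prems in auto)
  then obtain v' vs' where v': "v' \<in> U" "vs = v' # vs'" "vs' \<in> set_pmf (vwalk k P (U - {v'}) v')"
    using Suc.prems(4) by auto
  then have "distinct vs' \<and> set vs' = U - {v'}" using Suc.prems by (intro Suc.IH) auto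
  with v' show ?case by auto
qed auto

lemma set_vertex_gen:
  assumes "\<And>i j. i \<noteq> j \<Longrightarrow> 0 < P i j" "1 \<le> n"
  shows "set_pmf (vertex_gen n P) \<subseteq> {H. is_ham n H}"
proof
  fix H assume "H \<in> set_pmf (vertex_gen n P)"
  then obtain v vs where v: "v \<in> {1..n}" "vs \<in> set_pmf (vwalk (n - 1) P ({1..n} - {v}) v)"
    "H = cyc_edges (v # vs)"
    using assms(2) unfolding vertex_gen_def by (auto simp: set_pmf_of_set)
  then have "distinct vs \<and> set vs = {1..n} - {v}" using assms(1) by (intro set_vwalk) auto
  with v(1) have "distinct (v # vs)" "set (v # vs) = {1..n}" by (simp_all add: insert_absorb)
  then show "H \<in> {H. is_ham n H}" unfolding is_ham_def using v by blast
qed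

section \<open>Edge-based generation\<close>

lemma Min_Max_doubleton:
  fixes a b :: nat
  shows "{Min {a, b}, Max {a, b}} = {a, b}"
  by (cases "a \<le> b") (auto simp: min_def max_def)

lemma edge_weight_pi_of:
  assumes "e \<in> kn_edges n"
  shows "edge_weight (pi_of n H) e = 2 * (if e \<in> H then pi_max n else pi_min n)"
proof -
  obtain a b where e: "e = {a, b}" "a \<noteq> b" using assms unfolding kn_edges_def by blast
  have "{Min e, Max e} = e" unfolding e by (rule Min_Max_doubleton)
  moreover from this have "{Max e, Min e} = e" by (simp add: insert_commute)
  moreover have "Min e \<noteq> Max e" using e by (auto simp: min_def max_def)
  ultimately show ?thesis unfolding edge_weight_def pi_of_def by simp
qed

lemma edge_weight_pos:
  assumes "e \<in> kn_edges n" "\<And>i j. i \<noteq> j \<Longrightarrow> 0 < P i j"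
  shows "0 < edge_weight P e"
proof -
  obtain a b where e: "e = {a, b}" "a \<noteq> b" using assms unfolding kn_edges_def by blast
  have "Min e \<noteq> Max e" using e by (auto simp: min_def max_def)
  then show ?thesis unfolding edge_weight_def using assms(2) by (intro add_pos_pos) auto
qed

text \<open>A vertex outside \<open>\<Union>(H - B)\<close> has both of its edges of
  \<open>H\<close> in \<open>B\<close>, so its degree is exhausted. Only vertices that still lack an
  edge of \<open>H\<close> can take a new one.\<close>

lemma admissible_covered:
  assumes "is_ham n H" "3 \<le> n" "finite B" "e \<in> admissible n B"
  shows "e \<subseteq> \<Union>(H - B)"
proof
  fix v assume v: "v \<in> e"
  then have "v \<in> {1..n}" using assms(4) unfolding admissible_def kn_edges_def by auto
  then have 2: "deg H v = 2" using deg_ham[OF assms(1,2)] by simp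
  have adm: "e \<notin> B" "deg (insert e B) v < 3" using assms(4) unfolding admissible_def by auto
  have "{f \<in> insert e B. v \<in> f} = insert e {f \<in> B. v \<in> f}" using v by auto
  then have "deg (insert e B) v = Suc (deg B v)"
    unfolding deg_def using adm assms(3) by simp
  show "v \<in> \<Union>(H - B)"
  proof (rule ccontr)
    assume "v \<notin> \<Union>(H - B)"
    then have "{f \<in> H. v \<in> f} \<subseteq> {f \<in> B. v \<in> f}" by auto
    then have "deg H v \<le> deg B v" unfolding deg_def using assms(3) by (intro card_mono) auto
    then show False using 2 adm \<open>deg (insert e B) v = Suc (deg B v)\<close> by simp
  qed
qed

text \<open>The missing edges of \<open>H\<close> have at most \<open>2 * m\<close> endpoints, hence
  the square. A bound of order \<open>n^2\<close> instead would lose a factor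
  \<open>1 + O(1 / h)\<close> with \<open>h\<close> heavy edges left, and these factors multiply to
  a power of \<open>n\<close>.\<close>

lemma card_admissible:
  assumes "is_ham n H" "3 \<le> n" "finite B" "card (H - B) \<le> m"
  shows "card (admissible n B) \<le> 4 * m ^ 2"
proof -
  let ?V = "\<Union>(H - B)"
  have finH: "finite (H - B)" using is_ham_finite[OF assms(1)] by simp
  have two: "finite e \<and> card e = 2" if "e \<in> H" for e
    using is_ham_kn[OF assms(1)] assms(2) that unfolding kn_edges_def by auto
  then have finV: "finite ?V" using finH by auto
  have "card ?V \<le> (\<Sum>e\<in>H - B. card e)" by (rule card_Union_le_sum_card)
  also have "\<dots> = 2 * card (H - B)" using two by simp
  finally have V: "card ?V \<le> 2 * m" using assms(4) by simp
  have "admissible n B \<subseteq> (\<lambda>(a, b). {a, b}) ` (?V \<times> ?V)"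
  proof
    fix e assume e: "e \<in> admissible n B"
    then obtain a b where ab: "e = {a, b}" unfolding admissible_def kn_edges_def by auto
    with admissible_covered[OF assms(1-3) e] show "e \<in> (\<lambda>(a, b). {a, b}) ` (?V \<times> ?V)" by auto
  qed
  then have "card (admissible n B) \<le> card ((\<lambda>(a, b). {a, b}) ` (?V \<times> ?V))"
    using finV by (intro card_mono) auto
  also have "\<dots> \<le> card (?V \<times> ?V)" using finV by (intro card_image_le) auto
  also have "\<dots> \<le> (2 * m) * (2 * m)" 
    unfolding card_cartesian_product using V by (intro mult_le_mono)
  finally show ?thesis by (simp add: power2_eq_square)
qed

lemma pi_ratio:
  assumes "3 \<le> n"
  shows "pi_min n = pi_max n * (1 / ((real n - 1) * (real n - 2)))"
proof -
  have "real n - 1 \<noteq> 0" "real n - 2 \<noteq> 0" "real n \<noteq> 0" using assms by auto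
  then show ?thesis unfolding pi_min_def pi_max_def by (simp add: divide_simps)
qed

lemma sum_edge_weight_le:
  assumes "3 \<le> n" "card (admissible n B \<inter> H) \<le> h" "card (admissible n B) \<le> k"
  shows "sum (edge_weight (pi_of n H)) (admissible n B)
    \<le> 2 * pi_max n * (real h + real k / ((real n - 1) * (real n - 2)))"
proof -
  let ?A = "admissible n B" and ?w = "1 / ((real n - 1) * (real n - 2))"
  have kn: "?A \<subseteq> kn_edges n" unfolding admissible_def by auto
  have "sum (edge_weight (pi_of n H)) ?A = (\<Sum>e\<in>?A. 2 * (if e \<in> H then pi_max n else pi_min n))"
    using kn by (intro sum.cong) (auto simp: edge_weight_pi_of)
  also have "\<dots> = (\<Sum>e\<in>?A. if e \<in> H then 2 * pi_max n else 2 * pi_min n)"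
    by (intro sum.cong) auto
  also have "\<dots> = 2 * pi_max n * card (?A \<inter> H) + 2 * pi_min n * card (?A \<inter> - H)"
    by (simp add: sum.If_cases)
  also have "\<dots> \<le> 2 * pi_max n * real h + 2 * pi_min n * real k"
  proof -
    have "card (?A \<inter> - H) \<le> card ?A" by (intro card_mono) auto
    then show ?thesis
      using assms pi_min_pos[of n] pi_max_pos[of n] by (intro add_mono mult_left_mono) auto
  qed
  also have "\<dots> = 2 * pi_max n * (real h + real k * ?w)"
    by (subst pi_ratio[OF assms(1)]) (simp only: algebra_simps)
  finally show ?thesis by simp
qed

text \<open>With \<open>r\<close> wanted edges left, the at most \<open>4 (r + 3)\<^sup>2\<close> admissible edges outside \<open>H\<close> have
  relative weight about \<open>1 / n\<^sup>2\<close> each; compared with \<open>h \<ge> r + 1\<close> they cost a factor \<open>1 + O(1/n)\<close>,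
  so that over all \<open>n\<close> steps only a constant factor is lost.\<close>

definition step_loss :: "nat \<Rightarrow> real" where
  "step_loss n = 1 / (1 + 48 / real n)"

text \<open>Up to \<open>step_loss n\<close>, only the heavy edges count as competitors. Their bound
  \<open>h\<close> is left open because before \<open>x\<close> all of \<open>D\<close> competes,
  afterwards only what is not yet blocked.\<close>

lemma pmf_edge_step_ge:
  assumes "is_ham n H" "4 \<le> n" "finite B" "e \<in> admissible n B"
    and "1 \<le> r" "r + 2 \<le> n" "card (H - B) \<le> r + 3" "card (admissible n B \<inter> H) \<le> h" "r + 1 \<le> h"
  shows "(if e \<in> H then 1 else 1 / ((real n - 1) * (real n - 2))) * step_loss n / real h
    \<le> pmf (weighted_pmf (edge_weight (pi_of n H)) (admissible n B)) e"
proof -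
  let ?A = "admissible n B" and ?f = "edge_weight (pi_of n H)" and ?d = "(real n - 1) * (real n - 2)"
  let ?u = "if e \<in> H then 1 else 1 / ?d"
  have n3: "3 \<le> n" using assms(2) by simp
  have kn: "?A \<subseteq> kn_edges n" unfolding admissible_def by auto
  have pos: "0 < ?f e'" if "e' \<in> ?A" for e'
    using kn that by (intro edge_weight_pos[of _ n] pi_of_pos[OF n3]) auto
  have sum_pos: "0 < sum ?f ?A" using assms(4) pos by (intro sum_pos) auto
  have d: "0 < ?d" using assms(2) by auto
  have "real (4 * (r + 3) ^ 2) = 4 * (real r + 3) * (real r + 3)" by (simp add: power2_eq_square)
  \<comment> \<open>One factor \<open>r + 3\<close> is at most \<open>2 * (r + 1)\<close> as
    \<open>1 \<le> r\<close>, the other at most \<open>n + 1\<close>; this leaves a single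
    \<open>r + 1\<close> to be absorbed by \<open>h\<close>.\<close>
  also have "\<dots> \<le> 4 * (2 * (real r + 1)) * (real n + 1)"
    using assms(5,6) by (intro mult_mono) auto
  also have "\<dots> = (real r + 1) * (8 * (real n + 1))" by (simp add: algebra_simps)
  also have "\<dots> \<le> real h * (48 * ?d / real n)"
  proof (rule mult_mono)
    have "8 * (real n + 1) * real n \<le> 48 * ?d"
    proof -
      \<comment> \<open>The difference of the two sides, arranged around \<open>n = 4\<close>, where
        it equals 128.\<close>
      have "0 \<le> (real n - 4) * (40 * real n + 8) + 128" using assms(2) by auto
      then show ?thesis by (simp add: algebra_simps)
    qed
    then show "8 * (real n + 1) \<le> 48 * ?d / real n" using assms(2) by (simp add: pos_le_divide_eq)
  qed (use assms(9) in auto)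
  finally have "real (4 * (r + 3) ^ 2) / ?d \<le> real h * (48 / real n)"
    using d by (simp add: pos_divide_le_eq mult.assoc)
  then have "real h + real (4 * (r + 3) ^ 2) / ?d \<le> real h * (1 + 48 / real n)"
    by (simp add: algebra_simps)
  moreover have "sum ?f ?A \<le> 2 * pi_max n * (real h + real (4 * (r + 3) ^ 2) / ?d)"
    by (intro sum_edge_weight_le n3 assms card_admissible[OF assms(1) n3 assms(3,7)])
  ultimately have sum_le: "sum ?f ?A \<le> 2 * pi_max n * (real h * (1 + 48 / real n))"
    using pi_max_pos[OF n3] by (smt (verit) mult_left_mono)
  have fe: "?f e = 2 * pi_max n * ?u"
    using kn assms(4) by (subst edge_weight_pi_of[of _ n]) (auto simp: pi_ratio[OF n3])
  have "?u * step_loss n / real h = ?f e / (2 * pi_max n * (real h * (1 + 48 / real n)))"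
    unfolding fe step_loss_def using pi_max_pos[OF n3] by simp
  also have "\<dots> \<le> ?f e / sum ?f ?A"
    using pos[OF assms(4)]
    by (intro divide_left_mono[OF sum_le] mult_pos_pos[OF less_le_trans[OF sum_pos sum_le] sum_pos]) simp
  also have "\<dots> = pmf (weighted_pmf ?f ?A) e"
    using pos sum_pos assms(4) by (subst pmf_weighted_pmf) (auto intro: less_imp_le)
  finally show ?thesis .
qed

lemma step_loss_pos: "0 < n \<Longrightarrow> 0 < step_loss n"
  by (simp add: step_loss_def add_pos_nonneg)

lemma step_loss_le_1: "0 < n \<Longrightarrow> step_loss n \<le> 1"
  unfolding step_loss_def by (subst divide_le_eq_1_pos) (simp_all add: add_pos_nonneg)

lemma step_loss_power:
  assumes "0 < n"
  shows "exp (- 48) \<le> step_loss n ^ n"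
proof -
  have "exp (- 48) = inverse (exp (48 / real n) ^ n)"
    using assms by (simp add: exp_minus exp_of_nat_mult[symmetric])
  also have "\<dots> \<le> inverse ((1 + 48 / real n) ^ n)"
    by (intro le_imp_inverse_le power_mono exp_ge_add_one_self zero_less_power add_nonneg_nonneg)
       (auto intro: add_pos_nonneg)
  also have "\<dots> = step_loss n ^ n"
    by (simp add: step_loss_def power_one_over inverse_eq_divide)
  finally show ?thesis .
qed

lemma pmf_ebuild_Suc_ge:
  assumes "\<not> is_ham n B" "finite G"
  shows "(\<Sum>e\<in>G. pmf (weighted_pmf (edge_weight P) (admissible n B)) e * pmf (ebuild n k P (insert e B)) y)
    \<le> pmf (ebuild n (Suc k) P B) y"
  using pmf_bind_ge_sum[OF assms(2)] assms(1) by (simp add: ebuild.simps(2))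

declare ebuild.simps(2) [simp del]

section \<open>Building the target of an exchange edge by edge\<close>

locale exchange =
  fixes n :: nat and H H' D :: sol and x d1 d2 e1 e2 :: "nat set"
  assumes n: "4 \<le> n" and ham: "is_ham n H" and ham': "is_ham n H'"
    and exchange: "is_exchange n H H' D x d1 d2 e1 e2"
begin

abbreviation "P \<equiv> pi_of n H"
abbreviation "K \<equiv> H - D"

lemma n3: "3 \<le> n" using n by simp

lemma ex:
  "K \<subseteq> H'" "x \<in> H'" "x \<notin> H" "D \<subseteq> H" "D \<inter> H' = {}" "card D \<le> 3" "d1 \<in> D" "d2 \<in> D" "d1 \<noteq> d2"
  "e1 \<in> K" "e2 \<in> K" "e1 \<noteq> e2" "x \<inter> d1 \<inter> e1 \<noteq> {}" "x \<inter> d2 \<inter> e2 \<noteq> {}"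
  "f \<in> D \<Longrightarrow> f \<noteq> d1 \<Longrightarrow> f \<noteq> d2 \<Longrightarrow> has_short_cycle n (insert f (insert x K))"
  using exchange by (simp_all add: is_exchange_def)

lemma fin: "finite H" "finite H'" "finite D" "finite K"
  using is_ham_finite[OF ham] is_ham_finite[OF ham'] finite_subset[OF ex(4)] by simp_all

lemma cards: "card H = n" "card H' = n" "2 \<le> card D" "card K + card D = n"
proof -
  show c: "card H = n" "card H' = n" using is_ham_card n3 ham ham' by auto
  have "card {d1, d2} \<le> card D" using ex fin by (intro card_mono) auto
  then show "2 \<le> card D" using ex(9) by simp
  have "card D \<le> n" using c ex(4) fin card_mono by metis
  then show "card K + card D = n" using c ex(4) fin by (simp add: card_Diff_subset)
qed

lemma not_ham: "B \<subset> H' \<Longrightarrow> \<not> is_ham n B"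
  using psubset_card_mono[OF fin(2), of B] is_ham_card[OF _ n3, of B] cards(2) by auto

lemma incident_not_admissible:
  assumes "x \<in> B" "e \<in> B" "d \<in> D" "B \<subseteq> H'" "e \<in> H" "x \<inter> d \<inter> e \<noteq> {}"
  shows "d \<notin> admissible n B"
proof
  assume "d \<in> admissible n B"
  then have lt: "deg (insert d B) v < 3" for v unfolding admissible_def by blast
  obtain v where v: "v \<in> x" "v \<in> d" "v \<in> e" using assms(6) by blast
  have "finite (insert d B)" using assms(4) fin finite_subset by auto
  then have "card {x, d, e} \<le> deg (insert d B) v"
    unfolding deg_def using v assms by (intro card_mono) auto
  moreover have "x \<noteq> d" "x \<noteq> e" "d \<noteq> e" using assms ex by auto
  ultimately show False using lt[of v] by simp
qed

text \<open>Every admissible edge lies within the two ends of the one missing edge \<open>f\<close>,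
  so the last draw is forced.\<close>

lemma final_edge:
  assumes "f \<in> H'"
  shows "1 \<le> pmf (ebuild n (Suc 0) P (H' - {f})) H'"
proof -
  let ?B = "H' - {f}"
  have "H' - ?B = {f}" using assms by auto
  then have f: "f \<in> admissible n ?B"
    using admissible_sub_ham[OF ham' n3, of ?B] by auto
  have "admissible n ?B \<subseteq> {f}"
  proof
    fix e assume e: "e \<in> admissible n ?B"
    then have "e \<subseteq> f"
      using admissible_covered[OF ham' n3 _ e] fin \<open>H' - ?B = {f}\<close> by simp
    moreover have "e \<in> kn_edges n" "f \<in> kn_edges n" using e f unfolding admissible_def by auto
    ultimately show "e \<in> {f}" unfolding kn_edges_def by auto
  qed
  then have A: "admissible n ?B = {f}" using f by auto
  have pos: "0 < edge_weight P f"
    using f pi_of_pos[OF n3] by (intro edge_weight_pos[of _ n]) (auto simp: admissible_def)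
  have "\<not> is_ham n ?B" using assms by (intro not_ham) auto
  moreover have "insert f ?B = H'" using assms by auto
  moreover have "pmf (weighted_pmf (edge_weight P) {f}) f = 1"
    using pos by (subst pmf_weighted_pmf) auto
  ultimately show ?thesis
    using pmf_ebuild_Suc_ge[of n ?B "{f}" P 0 H'] by (simp add: A)
qed

text \<open>All of \<open>D\<close> is blocked now: \<open>d1\<close> and \<open>d2\<close> by
  degree, a third edge by the short cycle. If two edges are missing, the admissible edges are thus
  all light, and by \<open>card_admissible\<close> there are at most \<open>36 = 4 * 3 ^ 2\<close>
  of them; a missing edge is hit with probability at least \<open>1 / 36\<close>. The last edge is
  forced.\<close>

lemma completion:
  "1 / 36 \<le> pmf (ebuild n (card D - 1) P (insert x K)) H'"
proof -
  let ?B = "insert x K"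
  have sub: "?B \<subseteq> H'" using ex by auto
  have cB: "card ?B + (card D - 1) = n" using cards fin ex by auto
  then have rest: "card (H' - ?B) = card D - 1"
  proof -
    have "card (H' - ?B) = card H' - card ?B" using sub fin by (intro card_Diff_subset) auto
    then show ?thesis using cards(2) cB by linarith
  qed
  consider "card D = 2" | "card D = 3" using cards(3) ex(6) by linarith
  then show ?thesis
  proof cases
    case 1
    then obtain f where f: "H' - ?B = {f}" using rest by (auto simp: card_1_singleton_iff)
    have "f \<in> H' - ?B" unfolding f by simp
    then have "f \<in> H'" by blast
    moreover have "?B = H' - {f}" unfolding f[symmetric] using sub by blast
    ultimately show ?thesis using final_edge[of f] 1 by simp
  next
    case 2
    then have "card (H' - ?B) = 2" using rest by simp
    then obtain f g where fg: "H' - ?B = {f, g}" "f \<noteq> g" by (meson card_2_iff)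
    have fgB: "f \<in> H' - ?B" "g \<in> H' - ?B" unfolding fg(1) by simp_all
    then have fgH: "f \<in> H'" "g \<in> H'" by blast+
    have "?B = H' - {f, g}" unfolding fg(1)[symmetric] using sub by blast
    then have B: "insert g ?B = H' - {f}" using fg(2) fgH by blast
    let ?A = "admissible n ?B"
    have g: "g \<in> ?A" using admissible_sub_ham[OF ham' n3 sub] fgB by blast
    have "H - ?B \<subseteq> D" by auto
    then have "card (H - ?B) \<le> 3" using fin card_mono[of D "H - ?B"] 2 by simp
    then have cA: "card ?A \<le> 36" using card_admissible[OF ham n3, of ?B 3] fin by simp
    have AH: "?A \<inter> H = {}"
    proof (rule ccontr)
      assume "?A \<inter> H \<noteq> {}"
      then obtain d where d: "d \<in> ?A" "d \<in> H" by blast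
      then have D: "d \<in> D" unfolding admissible_def by auto
      have "d \<noteq> d1" using incident_not_admissible[of ?B e1 d1] d sub ex by auto
      moreover have "d \<noteq> d2" using incident_not_admissible[of ?B e2 d2] d sub ex by auto
      ultimately have "has_short_cycle n (insert d ?B)" using ex D by blast
      then show False using d unfolding admissible_def by blast
    qed
    have w: "edge_weight P e = 2 * pi_min n" if "e \<in> ?A" for e
      using that AH by (subst edge_weight_pi_of[of _ n]) (auto simp: admissible_def)
    have pos: "0 < pi_min n" using pi_min_pos[OF n3] .
    have "0 < card ?A" using g by (auto simp: card_gt_0_iff)
    then have "pmf (weighted_pmf (edge_weight P) ?A) g = 1 / card ?A"
      using pos g w by (subst pmf_weighted_pmf) (simp_all add: w)
    also have "\<dots> \<ge> 1 / 36" using cA \<open>0 < card ?A\<close> by (intro divide_left_mono) auto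
    finally have step: "1 / 36 \<le> pmf (weighted_pmf (edge_weight P) ?A) g" .
    have "\<not> is_ham n ?B" using sub fgB by (intro not_ham) blast
    then have "pmf (weighted_pmf (edge_weight P) ?A) g * pmf (ebuild n (Suc 0) P (insert g ?B)) H'
      \<le> pmf (ebuild n (Suc (Suc 0)) P ?B) H'"
      using pmf_ebuild_Suc_ge[of n ?B "{g}" P "Suc 0" H'] by simp
    moreover have "1 / 36 * 1 \<le> pmf (weighted_pmf (edge_weight P) ?A) g * pmf (ebuild n (Suc 0) P (insert g ?B)) H'"
      using step final_edge[OF fgH(1)] unfolding B by (intro mult_mono) auto
    moreover have "card D - 1 = Suc (Suc 0)" using 2 by simp
    ultimately show ?thesis by simp
  qed
qed

lemma sum_two_one:
  assumes "finite G" "E \<subseteq> G"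
  shows "(\<Sum>e\<in>G. if e \<in> E then 2 else 1 :: real) = real (card G) + real (card E)"
proof -
  have "(\<Sum>e\<in>G. if e \<in> E then 2 else 1 :: real) = (\<Sum>e\<in>G. 1 + (if e \<in> E then 1 else 0))"
    by (intro sum.cong) auto
  also have "\<dots> = real (card G) + real (card (G \<inter> E))"
    using assms(1) by (simp add: sum.distrib sum.If_cases)
  also have "G \<inter> E = E" using assms(2) by blast
  finally show ?thesis .
qed

text \<open>Once \<open>x\<close> is present, \<open>d1\<close> is blocked as soon as \<open>e1\<close> is there, and \<open>d2\<close> as soon as \<open>e2\<close> is.
  In a uniformly random order of the relevant edges, \<open>e1\<close> precedes \<open>d1\<close> and \<open>e2\<close> precedes \<open>d2\<close>
  with constant probability, and the one remaining edge of \<open>D\<close> comes last with probability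
  \<open>1 / (r + 1)\<close>.\<close>

lemma after_x:
  assumes "B \<subseteq> K" "card (K - B) = r"
  shows "step_loss n ^ r * (1 / 2) ^ card ({e1, e2} - B) / (real r + 1) * (1 / 36)
    \<le> pmf (ebuild n (r + (card D - 1)) P (insert x B)) H'"
  using assms
proof (induction r arbitrary: B)
  case 0
  then have "B = K" using fin by auto
  moreover from this have "{e1, e2} - B = {}" using ex by auto
  ultimately show ?case using completion by simp
next
  case (Suc r)
  let ?B = "insert x B" and ?G = "K - B" and ?E = "{e1, e2} - B"
  let ?A = "admissible n ?B"
  define c where "c = card ?E"
  \<comment> \<open>Heavy competitors: \<open>Suc r\<close> wanted edges, at most one edge of
    \<open>D\<close> besides \<open>d1\<close> and \<open>d2\<close>, and one of \<open>d1\<close>,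
    \<open>d2\<close> for each of \<open>e1\<close>, \<open>e2\<close> that is still
    missing.\<close>
  define h where "h = Suc r + 1 + c"
  have sub: "?B \<subseteq> H'" using ex(1,2) Suc.prems(1) by blast
  have finB: "finite ?B" by (rule finite_subset[OF sub fin(2)])
  have "?G \<noteq> {}" using Suc.prems(2) by (metis card.empty nat.distinct(1))
  then have "H' - ?B \<noteq> {}" using ex(1,3) by blast
  then have not: "\<not> is_ham n ?B" using sub by (intro not_ham) blast
  have GA: "?G \<subseteq> ?A" using admissible_sub_ham[OF ham' n3 sub] ex(1,3) by blast
  have E: "?E \<subseteq> ?G" using ex(10,11) by blast
  have cG: "card ?G = Suc r" "finite ?G" using Suc.prems fin(4) by simp_all
  have Ah: "card (?A \<inter> H) \<le> h"
  proof -
    let ?d1 = "if e1 \<in> B then {} else {d1}" and ?d2 = "if e2 \<in> B then {} else {d2}"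
    have "d1 \<notin> ?A" if "e1 \<in> B" 
      using incident_not_admissible[of ?B e1 d1] that sub ex(7,10,13) by blast
    moreover have "d2 \<notin> ?A" if "e2 \<in> B" 
      using incident_not_admissible[of ?B e2 d2] that sub ex(8,11,14) by blast
    moreover have "?A \<inter> B = {}" unfolding admissible_def by auto
    ultimately have "?A \<inter> H \<subseteq> ?G \<union> ((?d1 \<union> ?d2) \<union> (D - {d1, d2}))" by auto
    then have "card (?A \<inter> H) \<le> card (?G \<union> ((?d1 \<union> ?d2) \<union> (D - {d1, d2})))"
      using fin by (intro card_mono) auto
    also have "\<dots> \<le> card ?G + (card (?d1 \<union> ?d2) + card (D - {d1, d2}))"
      by (meson add_left_mono card_Un_le le_trans)
    also have "card (?d1 \<union> ?d2) = c" unfolding c_def using ex(9,12) by (simp add: insert_Diff_if)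
    also have "card (D - {d1, d2}) \<le> 1" using ex(6-9) fin(3) by (simp add: card_Diff_subset)
    finally show ?thesis using cG by (simp add: h_def)
  qed
  have HB: "card (H - ?B) \<le> Suc r + 3"
  proof -
    have "card (H - ?B) \<le> card (?G \<union> D)" using fin by (intro card_mono) auto
    also have "\<dots> \<le> card ?G + card D" by (rule card_Un_le)
    finally show ?thesis using cG ex(6) by simp
  qed
  have "Suc r \<le> card K" using card_mono[OF fin(4), of ?G] cG(1) by simp
  then have rn: "Suc r + 2 \<le> n" using cards by simp
  have step: "step_loss n / real h \<le> pmf (weighted_pmf (edge_weight P) ?A) e" if "e \<in> ?G" for e
    using pmf_edge_step_ge[OF ham n finB _ _ rn HB Ah, of e] that GA by (auto simp: h_def)
  \<comment> \<open>Drawing a missing \<open>e1\<close> or \<open>e2\<close> removes one factor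
    \<open>1 / 2\<close>, whence the 2.\<close>
  let ?L = "\<lambda>e. step_loss n ^ r * ((1 / 2) ^ c * (if e \<in> ?E then 2 else 1)) / (real r + 1) * (1 / 36)"
  have IH: "?L e \<le> pmf (ebuild n (r + (card D - 1)) P (insert e ?B)) H'" if e: "e \<in> ?G" for e
  proof -
    have "K - insert e B = ?G - {e}" by auto
    then have "card (K - insert e B) = r" using e cG by (simp add: card_Diff_singleton)
    moreover have "insert e B \<subseteq> K" using e Suc.prems(1) by blast
    ultimately have "step_loss n ^ r * (1 / 2) ^ card ({e1, e2} - insert e B) / (real r + 1) * (1 / 36)
      \<le> pmf (ebuild n (r + (card D - 1)) P (insert x (insert e B))) H'"
      using Suc.IH by blast
    moreover have "(1 / 2 :: real) ^ card ({e1, e2} - insert e B) = (1 / 2) ^ c * (if e \<in> ?E then 2 else 1)"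
    proof -
      have *: "{e1, e2} - insert e B = ?E - {e}" by auto
      show ?thesis
      proof (cases "e \<in> ?E")
        case True
        then have "c = Suc (card (?E - {e}))" unfolding c_def by (intro card.remove) auto
        then show ?thesis unfolding * using True by simp
      qed (simp add: * c_def)
    qed
    ultimately show ?thesis by (simp add: insert_commute)
  qed
  let ?R = "real r + 1"
  have sumE: "(\<Sum>e\<in>?G. if e \<in> ?E then 2 else 1 :: real) = ?R + real c"
    using sum_two_one[OF cG(2) E] cG(1) by (simp add: c_def)
  \<comment> \<open>Cross-multiplied this says \<open>0 \<le> c\<close>: the doubled terms raise the
    numerator to \<open>?R + c\<close> and so pay for the \<open>c\<close> extra competitors in
    \<open>h\<close>.\<close>
  have arith: "1 / (?R + 1) \<le> (?R + real c) / (real h * ?R)"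
    unfolding h_def by (simp add: divide_simps) (simp add: algebra_simps)
  have "step_loss n ^ Suc r * (1 / 2) ^ c / (real (Suc r) + 1) * (1 / 36)
    = step_loss n ^ Suc r * (1 / 2) ^ c * (1 / 36) * (1 / (?R + 1))" by simp
  also have "\<dots> \<le> step_loss n ^ Suc r * (1 / 2) ^ c * (1 / 36) * ((?R + real c) / (real h * ?R))"
    using step_loss_pos[of n] n arith by (intro mult_left_mono) auto
  also have "\<dots> = (\<Sum>e\<in>?G. step_loss n / real h * ?L e)"
    unfolding sumE[symmetric] by (simp add: sum_distrib_left sum_divide_distrib mult_ac)
  also have "\<dots> \<le> (\<Sum>e\<in>?G. pmf (weighted_pmf (edge_weight P) ?A) e *
      pmf (ebuild n (r + (card D - 1)) P (insert e ?B)) H')"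
    using step IH step_loss_pos[of n] n by (intro sum_mono mult_mono) auto
  also have "\<dots> \<le> pmf (ebuild n (Suc r + (card D - 1)) P ?B) H'"
    using pmf_ebuild_Suc_ge[OF not cG(2)] by simp
  finally show ?case by (simp add: c_def)
qed

text \<open>The edge \<open>x\<close> may enter at any time. If it does so with \<open>r\<close> wanted edges left, then no edge
  of \<open>D\<close> was chosen before with probability about \<open>(r / n)\<^sup>3\<close>, \<open>x\<close> is chosen with probability
  about \<open>1 / (r n\<^sup>2)\<close>, and the rest succeeds with probability about \<open>1 / r\<close>; summing over \<open>r\<close>
  gives order \<open>1 / n\<^sup>3\<close>.\<close>

lemma before_x:
  assumes "B \<subseteq> K" "card (K - B) = r"
  shows "step_loss n ^ Suc r * (1 / ((real n - 1) * (real n - 2))) / 144 *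
      (real r ^ 2 / (2 * (real r + 1) * (real r + 2) * (real r + 3)))
    \<le> pmf (ebuild n (Suc r + (card D - 1)) P B) H'"
  using assms
proof (induction r arbitrary: B)
  case 0
  then show ?case by simp
next
  case (Suc r)
  let ?w = "1 / ((real n - 1) * (real n - 2))"
  let ?G = "K - B" and ?A = "admissible n B"
  define R where "R = real r + 1"
  \<comment> \<open>No blocking is available before \<open>x\<close>, so up to three edges of
    \<open>D\<close> compete.\<close>
  define h where "h = Suc r + 3"
  have w: "0 \<le> ?w" using n by simp
  have sub: "B \<subseteq> H'" using ex(1) Suc.prems(1) by blast
  have finB: "finite B" by (rule finite_subset[OF sub fin(2)])
  have xB: "x \<notin> B" using ex(3) Suc.prems(1) by blast
  then have not: "\<not> is_ham n B" using sub ex(2) by (intro not_ham) blast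
  have GA: "?G \<subseteq> ?A" and xA: "x \<in> ?A" using admissible_sub_ham[OF ham' n3 sub] ex(1,2) xB by blast+
  have cG: "card ?G = Suc r" "finite ?G" using Suc.prems fin(4) by simp_all
  have HB: "card (H - B) \<le> h"
  proof -
    have "card (H - B) \<le> card (?G \<union> D)" using fin by (intro card_mono) auto
    also have "\<dots> \<le> card ?G + card D" by (rule card_Un_le)
    finally show ?thesis using cG ex(6) by (simp add: h_def)
  qed
  have "?A \<inter> H \<subseteq> H - B" unfolding admissible_def by auto
  then have "card (?A \<inter> H) \<le> card (H - B)" using fin by (intro card_mono) auto
  then have Ah: "card (?A \<inter> H) \<le> h" using HB by simp
  have "Suc r \<le> card K" using card_mono[OF fin(4), of ?G] cG(1) by simp
  then have rn: "Suc r + 2 \<le> n" using cards by simp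
  note step = pmf_edge_step_ge[OF ham n finB _ _ rn HB[unfolded h_def] Ah]
  have stepG: "step_loss n / real h \<le> pmf (weighted_pmf (edge_weight P) ?A) e" if "e \<in> ?G" for e
    using step[of e] that GA by (auto simp: h_def)
  have stepx: "?w * step_loss n / real h \<le> pmf (weighted_pmf (edge_weight P) ?A) x"
    using step[of x] xA ex(3) by (simp add: h_def)
  let ?L = "step_loss n ^ Suc r * ?w / 144 *
      (real r ^ 2 / (2 * (real r + 1) * (real r + 2) * (real r + 3)))"
  have IH: "?L \<le> pmf (ebuild n (Suc r + (card D - 1)) P (insert e B)) H'" if e: "e \<in> ?G" for e
  proof -
    have "K - insert e B = ?G - {e}" by auto
    then have "card (K - insert e B) = r" using e cG by (simp add: card_Diff_singleton)
    moreover have "insert e B \<subseteq> K" using e Suc.prems(1) by blast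
    ultimately show ?thesis using Suc.IH by blast
  qed
  \<comment> \<open>In the worst case neither \<open>e1\<close> nor \<open>e2\<close> is present,
    which costs \<open>(1 / 2) ^ 2\<close>; with the \<open>1 / 36\<close> of
    \<open>completion\<close> this gives the 144.\<close>
  have afterx: "step_loss n ^ Suc r * (1 / 4) / (real (Suc r) + 1) * (1 / 36)
      \<le> pmf (ebuild n (Suc r + (card D - 1)) P (insert x B)) H'"
  proof -
    have "card ({e1, e2} - B) \<le> card {e1, e2}" by (intro card_mono) auto
    then have "card ({e1, e2} - B) \<le> 2" using ex by simp
    then have "(1 / 2 :: real) ^ 2 \<le> (1 / 2) ^ card ({e1, e2} - B)" by (intro power_decreasing) auto
    then have "step_loss n ^ Suc r * (1 / 4) / (real (Suc r) + 1) * (1 / 36)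
      \<le> step_loss n ^ Suc r * (1 / 2) ^ card ({e1, e2} - B) / (real (Suc r) + 1) * (1 / 36)"
      using step_loss_pos[of n] n
      by (intro mult_right_mono divide_right_mono mult_left_mono) (auto simp: power2_eq_square)
    then show ?thesis using after_x[OF Suc.prems] by linarith
  qed
  let ?C = "step_loss n ^ Suc (Suc r) * ?w / 144"
  have C: "0 \<le> ?C" using step_loss_pos[of n] n w by auto
  have R: "1 \<le> R" by (simp add: R_def)
  \<comment> \<open>The recursion that the fraction is designed for: with \<open>R\<close> wanted
    edges left, the next edge is \<open>x\<close> (first term) or a wanted one (second term). Over
    the common denominator the right side has numerator \<open>R ^ 2 + 5\<close>. The fraction
    vanishes at 0, which makes the base case trivial.\<close>
  have arith: "R ^ 2 / (2 * (R + 1) * (R + 2) * (R + 3))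
    \<le> 1 / (R + 3) * (1 / (R + 1)) + R / (R + 3) * ((R - 1) ^ 2 / (2 * R * (R + 1) * (R + 2)))"
  proof -
    have "1 / (R + 3) * (1 / (R + 1)) + R / (R + 3) * ((R - 1) ^ 2 / (2 * R * (R + 1) * (R + 2)))
       = (R ^ 2 + 5) / (2 * (R + 1) * (R + 2) * (R + 3))"
      using R by (simp add: divide_simps) (simp add: algebra_simps power2_eq_square)
    moreover have "R ^ 2 / (2 * (R + 1) * (R + 2) * (R + 3)) \<le> (R ^ 2 + 5) / (2 * (R + 1) * (R + 2) * (R + 3))"
      using R by (intro divide_right_mono) auto
    ultimately show ?thesis by simp
  qed
  have hR: "real h = R + 3" "real r = R - 1" "real (Suc r) = R" by (simp_all add: h_def R_def)
  have "?C * (R ^ 2 / (2 * (R + 1) * (R + 2) * (R + 3)))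
    \<le> ?C * (1 / (R + 3) * (1 / (R + 1)) + R / (R + 3) * ((R - 1) ^ 2 / (2 * R * (R + 1) * (R + 2))))"
    using arith C by (rule mult_left_mono)
  also have "\<dots> = ?w * step_loss n / real h * (step_loss n ^ Suc r * (1 / 4) / (real (Suc r) + 1) * (1 / 36))
      + (\<Sum>e\<in>?G. step_loss n / real h * ?L)"
    using cG by (simp add: hR algebra_simps)
  also have "\<dots> \<le> pmf (weighted_pmf (edge_weight P) ?A) x * pmf (ebuild n (Suc r + (card D - 1)) P (insert x B)) H'
      + (\<Sum>e\<in>?G. pmf (weighted_pmf (edge_weight P) ?A) e *
      pmf (ebuild n (Suc r + (card D - 1)) P (insert e B)) H')"
    using step_loss_pos[of n] n w
    by (intro add_mono mult_mono sum_mono stepx stepG afterx IH) auto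
  also have "\<dots> = (\<Sum>e\<in>insert x ?G. pmf (weighted_pmf (edge_weight P) ?A) e *
      pmf (ebuild n (Suc r + (card D - 1)) P (insert e B)) H')"
    using cG(2) ex(3) by simp
  also have "\<dots> \<le> pmf (ebuild n (Suc (Suc r) + (card D - 1)) P B) H'"
    using pmf_ebuild_Suc_ge[OF not, of "insert x ?G"] cG by simp
  finally show ?case by (simp only: hR(3))
qed

lemma edge_gen_exchange: "exp (- 48) / 18432 / real n ^ 3 \<le> pmf (edge_gen n P) H'"
proof -
  define r where "r = card K"
  have r: "r + card D = n" "r + 2 \<le> n" "n \<le> r + 3" using cards ex unfolding r_def by auto
  then have r1: "1 \<le> r" using n by simp
  let ?g = "real r ^ 2 / (2 * (real r + 1) * (real r + 2) * (real r + 3))"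
  \<comment> \<open>\<open>n \<le> r + 3\<close> and \<open>1 \<le> r\<close> give
    \<open>n / 4 \<le> r\<close>; the factors in the denominator are at most \<open>n\<close>,
    \<open>n\<close> and \<open>4 * n\<close>. The final constant is
    \<open>18432 = 144 * 128\<close>.\<close>
  have "1 / (128 * real n) = (real n / 4) ^ 2 / (2 * real n * real n * (4 * real n))"
    using n by (simp add: field_simps power2_eq_square)
  also have "\<dots> \<le> ?g"
    using r r1 n by (intro frac_le mult_mono power_mono mult_pos_pos) auto
  finally have g: "1 / (128 * real n) \<le> ?g" .
  have loss: "exp (- 48) \<le> step_loss n ^ Suc r"
  proof -
    have "step_loss n ^ n \<le> step_loss n ^ Suc r"
      using r n step_loss_pos[of n] step_loss_le_1[of n] by (intro power_decreasing) auto
    then show ?thesis using step_loss_power[of n] n by simp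
  qed
  have w: "1 / real n ^ 2 \<le> 1 / ((real n - 1) * (real n - 2))"
    unfolding power2_eq_square using n by (intro divide_left_mono mult_mono mult_pos_pos) auto
  have "exp (- 48) / 18432 / real n ^ 3 = exp (- 48) * (1 / real n ^ 2) / 144 * (1 / (128 * real n))"
    by (simp add: power2_eq_square power3_eq_cube)
  also have "\<dots> \<le> step_loss n ^ Suc r * (1 / ((real n - 1) * (real n - 2))) / 144 * ?g"
    using step_loss_pos[of n] n by (intro mult_mono divide_right_mono loss w g) auto
  also have "\<dots> \<le> pmf (ebuild n (Suc r + (card D - 1)) P {}) H'"
    using before_x[of "{}" r] by (simp add: r_def)
  also have "Suc r + (card D - 1) = n" using r cards by simp
  finally show ?thesis by (simp add: edge_gen_def)
qed

end

lemma edge_gen_improving: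
  assumes "is_ham n H" "4 \<le> n" "improving n H"
  shows "\<exists>H'. is_ham n H' \<and> level n H < level n H' \<and>
    exp (- 48) / 18432 / real n ^ 3 \<le> pmf (edge_gen n (pi_of n H)) H'"
proof -
  from assms(3) obtain vs D x d1 d2 e1 e2 where vs: "distinct vs" "set vs = {1..n}"
    "is_exchange n H (cyc_edges vs) D x d1 d2 e1 e2" "level n H < level n (cyc_edges vs)"
    unfolding improving_def by blast
  have ham': "is_ham n (cyc_edges vs)" unfolding is_ham_def using vs by blast
  interpret exchange n H "cyc_edges vs" D x d1 d2 e1 e2
    by (rule exchange.intro[OF assms(2,1) ham' vs(3)])
  show ?thesis using edge_gen_exchange ham' vs by blast
qed

text \<open>The build cannot get stuck: a linear forest lies in some Hamiltonian cycle, whose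
  missing edges are admissible. With \<open>n\<close> edges it fills that cycle.\<close>

lemma set_ebuild:
  assumes "\<And>i j. i \<noteq> j \<Longrightarrow> 0 < P i j" "3 \<le> n"
    and "is_ham n B \<or> (\<exists>F. path_system n F B)" "card B + k = n"
  shows "set_pmf (ebuild n k P B) \<subseteq> {H. is_ham n H}"
  using assms(3,4)
proof (induction k arbitrary: B)
  case 0
  have "is_ham n B"
  proof (cases "is_ham n B")
    case False
    then obtain H where H: "is_ham n H" "B \<subseteq> H"
      using 0 assms(2) path_system_ham[of n _ B] by auto
    then have "B = H" using 0 is_ham_card[OF H(1) assms(2)] is_ham_finite[OF H(1)]
      by (intro card_seteq) auto
    then show ?thesis using H by simp
  qed
  then show ?case by simp
next
  case (Suc k)
  show ?case
  proof (cases "is_ham n B")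
    case False
    then obtain F where F: "path_system n F B" using Suc.prems by blast
    then obtain H where H: "is_ham n H" "B \<subseteq> H" using assms(2) path_system_ham[of n F B] by auto
    have "B \<noteq> H" using False H by auto
    then have ne: "admissible n B \<noteq> {}" using admissible_sub_ham[OF H(1) assms(2) H(2)] H by auto
    have "finite B" using H is_ham_finite finite_subset by blast
    have supp: "set_pmf (weighted_pmf (edge_weight P) (admissible n B)) \<subseteq> admissible n B"
      using ne by (intro set_weighted_pmf edge_weight_pos[of _ n] assms(1)) (auto simp: admissible_def)
    have "set_pmf (ebuild n k P (insert e B)) \<subseteq> {H. is_ham n H}" if "e \<in> admissible n B" for e
    proof (rule Suc.IH)
      show "is_ham n (insert e B) \<or> (\<exists>F. path_system n F (insert e B))"
        using path_system_step[OF F that assms(2)] .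
      have "e \<notin> B" using that unfolding admissible_def by blast
      then show "card (insert e B) + k = n" using Suc.prems \<open>finite B\<close> by simp
    qed
    then show ?thesis using False supp by (auto simp: ebuild.simps(2))
  qed (simp add: ebuild.simps(2))
qed

lemma set_edge_gen:
  assumes "\<And>i j. i \<noteq> j \<Longrightarrow> 0 < P i j" "3 \<le> n"
  shows "set_pmf (edge_gen n P) \<subseteq> {H. is_ham n H}"
  unfolding edge_gen_def using path_system_empty by (intro set_ebuild assms) auto

section \<open>The cross-entropy run\<close>

lemma prob_samples_avoid:
  "measure_pmf.prob (samples N p) {xs. y \<notin> set xs} = (1 - pmf p y) ^ N"
proof (induction N)
  case (Suc N)
  let ?q = "(1 - pmf p y) ^ N"
  have "measure_pmf.prob (samples (Suc N) p) {xs. y \<notin> set xs}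
      = pmf (map_pmf (\<lambda>xs. y \<notin> set xs) (samples (Suc N) p)) True"
    by (simp add: pmf_map vimage_def)
  also have "\<dots> = (\<integral>x. (if x = y then 0 else ?q) \<partial>measure_pmf p)"
  proof -
    have "pmf (map_pmf (\<lambda>xs. y \<notin> set xs) (map_pmf ((#) x) (samples N p))) True = (if x = y then 0 else ?q)" for x
      using Suc by (simp add: pmf_map vimage_def)
    then show ?thesis by (simp add: map_bind_pmf pmf_bind)
  qed
  also have "\<dots> = (\<integral>x. ?q * indicator (- {y}) x \<partial>measure_pmf p)"
    by (intro Bochner_Integration.integral_cong) (auto simp: indicator_def)
  also have "\<dots> = ?q * measure_pmf.prob p (- {y})" by simp
  also have "measure_pmf.prob p (- {y}) = 1 - pmf p y"
    using measure_pmf.prob_compl[of "{y}" p] by (simp add: Compl_eq_Diff_UNIV measure_pmf_single)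
  finally show ?case by simp
qed simp

lemma set_samples: "xs \<in> set_pmf (samples N p) \<Longrightarrow> length xs = N \<and> set xs \<subseteq> set_pmf p"
proof (induction N arbitrary: xs)
  case (Suc N)
  then obtain x ys where "xs = x # ys" "x \<in> set_pmf p" "ys \<in> set_pmf (samples N p)"
    by auto
  then show ?case using Suc.IH[of ys] by simp
qed simp

text \<open>One step of a union bound over the iterations: \<open>A\<close> is the bad event of the
  current one, \<open>r\<close> bounds the failure of the rest.\<close>

lemma pmf_bind_le_off_event:
  assumes "0 \<le> r" "\<And>x. x \<in> set_pmf p \<Longrightarrow> x \<notin> A \<Longrightarrow> pmf (f x) y \<le> r"
  shows "pmf (bind_pmf p f) y \<le> measure_pmf.prob p A + r"
proof -
  have "pmf (bind_pmf p f) y = (\<integral>x. pmf (f x) y \<partial>measure_pmf p)" by (simp add: pmf_bind)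
  also have "\<dots> \<le> (\<integral>x. indicator A x + r \<partial>measure_pmf p)"
  proof (intro integral_mono_AE)
    show "AE x in measure_pmf p. pmf (f x) y \<le> indicator A x + r"
      using assms by (auto simp: AE_measure_pmf_iff indicator_def intro: order_trans[OF pmf_le_1])
    show "integrable (measure_pmf p) (\<lambda>x. pmf (f x) y)"
      by (rule integrable_pmf_bounded[of _ 1]) (simp_all add: pmf_le_1)
    show "integrable (measure_pmf p) (\<lambda>x. indicat_real A x + r)"
      by (rule integrable_pmf_bounded[of _ "1 + r"]) (use assms(1) in \<open>simp_all add: indicator_def\<close>)
  qed
  also have "\<dots> = measure_pmf.prob p A + r"
  proof -
    have "integrable (measure_pmf p) (indicat_real A)"
      by (rule integrable_pmf_bounded[of _ 1]) (simp_all add: indicator_def)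
    then show ?thesis by simp
  qed
  finally show ?thesis .
qed

lemma selected_is_ham:
  assumes "valid_sel sel" "xs \<noteq> []" "set xs \<subseteq> {H. is_ham n H}"
  shows "is_ham n (sel n xs)"
  using assms unfolding valid_sel_def by blast

text \<open>A cheaper cycle has a higher level, so one improving sample lifts the selected solution,
  even if another sample is selected.\<close>

lemma selected_level:
  assumes "valid_sel sel" "3 \<le> n" "set xs \<subseteq> {H. is_ham n H}" "y \<in> set xs"
  shows "level n y \<le> level n (sel n xs)"
proof -
  have "is_ham n (sel n xs)" using assms by (intro selected_is_ham) auto
  moreover have "cost (dist_G1 n) (sel n xs) \<le> cost (dist_G1 n) y"
    using assms unfolding valid_sel_def by (metis empty_iff empty_set)
  ultimately show ?thesis
    using cost_less_iff[of n "sel n xs" y] assms by fastforce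
qed

text \<open>Every iteration raises the level by at least one unless the improving solution is
  missed by all samples, so \<open>n\<close> iterations after the first one suffice.\<close>

lemma success_prob_ge:
  fixes gen :: "nat \<Rightarrow> mat \<Rightarrow> sol pmf"
  assumes sel: "valid_sel sel" and n: "3 \<le> n" and N: "0 < N" and p: "0 \<le> p" "p \<le> 1"
    and supp: "\<And>P. (\<And>i j. i \<noteq> j \<Longrightarrow> 0 < P i j) \<Longrightarrow> set_pmf (gen n P) \<subseteq> {H. is_ham n H}"
    and impr: "\<And>H. is_ham n H \<Longrightarrow> improving n H \<Longrightarrow>
      \<exists>H'. is_ham n H' \<and> level n H < level n H' \<and> p \<le> pmf (gen n (pi_of n H)) H'"
  shows "1 - real n * (1 - p) ^ N \<le> success_prob gen sel N n n"
proof -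
  define opt where "opt = is_opt n (dist_G1 n)"
  let ?run = "\<lambda>T P. ce_found (gen n) (sel n) opt (pi_of n) N T P"
  let ?q = "(1 - p) ^ N"
  have supp': "xs \<noteq> [] \<and> set xs \<subseteq> {H. is_ham n H}"
    if "xs \<in> set_pmf (samples N (gen n P))" "\<And>i j. i \<noteq> j \<Longrightarrow> 0 < P i j" for xs P
    using set_samples[OF that(1)] supp[of P] that(2) N by auto
  have opt: "opt H" if "is_ham n H" "n \<le> level n H" for H
    unfolding opt_def using is_opt_level that n by blast
  have q: "0 \<le> ?q" using p by simp
  have miss: "\<exists>A. measure_pmf.prob (samples N (gen n (pi_of n H))) A \<le> ?q \<and>
      (\<forall>xs\<in>set_pmf (samples N (gen n (pi_of n H))). xs \<notin> A \<longrightarrow>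
        is_ham n (sel n xs) \<and> level n H < level n (sel n xs))"
    if H: "is_ham n H" "\<not> opt H" for H
  proof -
    have "level n H < n" using opt[OF H(1)] H(2) by force
    then obtain H' where H': "is_ham n H'" "level n H < level n H'" "p \<le> pmf (gen n (pi_of n H)) H'"
      using impr[OF H(1)] improving_nonopt[OF H(1) n] by blast
    let ?A = "{xs. H' \<notin> set xs}"
    have "measure_pmf.prob (samples N (gen n (pi_of n H))) ?A \<le> ?q"
      unfolding prob_samples_avoid using H'(3) by (intro power_mono) (auto simp: pmf_le_1)
    moreover have "is_ham n (sel n xs) \<and> level n H < level n (sel n xs)"
      if "xs \<in> set_pmf (samples N (gen n (pi_of n H)))" "xs \<notin> ?A" for xs
    proof -
      have xs: "xs \<noteq> []" "set xs \<subseteq> {H. is_ham n H}"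
        using supp'[OF that(1)] pi_of_pos[OF n] by blast+
      have "level n H' \<le> level n (sel n xs)"
        using selected_level[OF sel n xs(2)] that(2) by simp
      then show ?thesis using selected_is_ham[OF sel xs] H'(2) by simp
    qed
    ultimately show ?thesis by blast
  qed
  \<comment> \<open>With counter \<open>T\<close>, \<open>ce_found\<close> makes up to
    \<open>T + 1\<close> iterations; hence \<open>Suc T\<close> in the assumption and in the
    bound.\<close>
  have run: "pmf (?run T (pi_of n H)) False \<le> real (Suc T) * ?q"
    if "is_ham n H" "\<not> opt H" "n \<le> level n H + Suc T" for T H
    using that
  proof (induction T arbitrary: H)
    case (0 H)
    obtain A where A: "measure_pmf.prob (samples N (gen n (pi_of n H))) A \<le> ?q"
      "\<And>xs. xs \<in> set_pmf (samples N (gen n (pi_of n H))) \<Longrightarrow> xs \<notin> A \<Longrightarrow>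
        is_ham n (sel n xs) \<and> level n H < level n (sel n xs)"
      using miss[OF 0(1,2)] by blast
    have "opt (sel n xs)" if "xs \<in> set_pmf (samples N (gen n (pi_of n H)))" "xs \<notin> A" for xs
      using A(2)[OF that] 0(3) by (intro opt) auto
    then have "pmf (?run 0 (pi_of n H)) False \<le> measure_pmf.prob (samples N (gen n (pi_of n H))) A + 0"
      unfolding ce_found.simps map_pmf_def by (intro pmf_bind_le_off_event) auto
    then show ?case using A(1) by simp
  next
    case (Suc T H)
    obtain A where A: "measure_pmf.prob (samples N (gen n (pi_of n H))) A \<le> ?q"
      "\<And>xs. xs \<in> set_pmf (samples N (gen n (pi_of n H))) \<Longrightarrow> xs \<notin> A \<Longrightarrow>
        is_ham n (sel n xs) \<and> level n H < level n (sel n xs)"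
      using miss[OF Suc.prems(1,2)] by blast
    have "pmf (if opt (sel n xs) then return_pmf True else ?run T (pi_of n (sel n xs))) False
        \<le> real (Suc T) * ?q"
      if "xs \<in> set_pmf (samples N (gen n (pi_of n H)))" "xs \<notin> A" for xs
    proof (cases "opt (sel n xs)")
      case True
      then show ?thesis using q by simp
    next
      case False
      then have "pmf (?run T (pi_of n (sel n xs))) False \<le> real (Suc T) * ?q"
        using A(2)[OF that] Suc.prems(3) by (intro Suc.IH) auto
      with False show ?thesis by simp
    qed
    then have "pmf (?run (Suc T) (pi_of n H)) False
        \<le> measure_pmf.prob (samples N (gen n (pi_of n H))) A + real (Suc T) * ?q"
      unfolding ce_found.simps using q by (intro pmf_bind_le_off_event) auto
    also have "\<dots> \<le> real (Suc (Suc T)) * ?q" using A(1) by (simp add: algebra_simps)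
    finally show ?case .
  qed
  \<comment> \<open>The iteration from \<open>pi0 n\<close> only has to deliver some Hamiltonian
    cycle, so its bad event is empty. The \<open>n\<close> iterations after it suffice even from
    level 0.\<close>
  obtain T where T: "n = Suc T" using n by (cases n) auto
  have "pmf (if opt (sel n xs) then return_pmf True else ?run T (pi_of n (sel n xs))) False
      \<le> real n * ?q"
    if "xs \<in> set_pmf (samples N (gen n (pi0 n)))" for xs
  proof (cases "opt (sel n xs)")
    case False
    have xs: "xs \<noteq> []" "set xs \<subseteq> {H. is_ham n H}"
      using supp'[OF that] pi0_pos[OF n] by blast+
    have "pmf (?run T (pi_of n (sel n xs))) False \<le> real (Suc T) * ?q"
      using selected_is_ham[OF sel xs] False T by (intro run) auto
    with False show ?thesis unfolding T by simp
  qed (use q in simp)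
  then have "pmf (?run n (pi0 n)) False \<le> measure_pmf.prob (samples N (gen n (pi0 n))) {} + real n * ?q"
    using q unfolding T ce_found.simps by (intro pmf_bind_le_off_event) auto
  moreover have "pmf (?run n (pi0 n)) True = 1 - pmf (?run n (pi0 n)) False"
    by (rule pmf_True_conv_False)
  ultimately show ?thesis
    unfolding success_prob_def opt_def[symmetric] by simp
qed

text \<open>Half of the exponent absorbs the factor \<open>n\<close> of the union bound:
  \<open>n * exp (- c * y) \<le> exp (- (c / 2) * y)\<close> as soon as
  \<open>ln n \<le> c / 2 * y\<close>, where \<open>y = N n / n ^ m\<close> is at least of order
  \<open>n powr \<epsilon>\<close>.\<close>

lemma success_asymptotics:
  fixes gen :: "nat \<Rightarrow> mat \<Rightarrow> sol pmf" and N :: "nat \<Rightarrow> nat" and m :: nat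
  assumes sel: "valid_sel sel" and \<epsilon>: "0 < \<epsilon>"
    and N: "(\<lambda>n. real (N n)) \<in> \<Omega>(\<lambda>n. real n powr (real m + \<epsilon>))"
    and supp: "\<And>n P. 4 \<le> n \<Longrightarrow> (\<And>i j. i \<noteq> j \<Longrightarrow> 0 < P i j) \<Longrightarrow> set_pmf (gen n P) \<subseteq> {H. is_ham n H}"
    and c: "0 < c" "c \<le> 1"
    and impr: "\<And>n H. 4 \<le> n \<Longrightarrow> is_ham n H \<Longrightarrow> improving n H \<Longrightarrow>
      \<exists>H'. is_ham n H' \<and> level n H < level n H' \<and> c / real n ^ m \<le> pmf (gen n (pi_of n H)) H'"
  shows "\<exists>c>0. \<forall>\<^sub>F n in at_top.
    success_prob gen sel (N n) n n \<ge> 1 - exp (- c * real (N n) / real n ^ m)"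
proof -
  obtain b where b: "0 < b" "\<forall>\<^sub>F n in at_top. b * norm (real n powr (real m + \<epsilon>)) \<le> norm (real (N n))"
    using N by (elim landau_omega.bigE)
  have "filterlim (\<lambda>n. c / 2 * b * real n powr \<epsilon> - ln (real n)) at_top at_top"
    using \<epsilon> b(1) c(1) by real_asymp
  then have "\<forall>\<^sub>F n in at_top. 0 \<le> c / 2 * b * real n powr \<epsilon> - ln (real n)"
    unfolding filterlim_at_top by blast
  with b(2) eventually_ge_at_top[of 4]
  have "\<forall>\<^sub>F n in at_top. success_prob gen sel (N n) n n \<ge> 1 - exp (- (c / 2) * real (N n) / real n ^ m)"
  proof eventually_elim
    case (elim n)
    let ?x = "real (N n) / real n ^ m"
    have n: "0 < real n" "0 < real n ^ m" using elim by auto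
    have "real n powr (real m + \<epsilon>) = real n powr \<epsilon> * real n ^ m"
      using n by (simp add: powr_add powr_realpow)
    then have "b * real n powr \<epsilon> * real n ^ m \<le> real (N n)" using elim by (simp add: mult_ac)
    then have x: "b * real n powr \<epsilon> \<le> ?x" using n by (simp add: pos_le_divide_eq)
    moreover have "0 < b * real n powr \<epsilon>" using b(1) n by simp
    ultimately have "0 < ?x" by linarith
    then have Npos: "0 < N n" using n by (simp add: zero_less_divide_iff)
    have "c / 2 * (b * real n powr \<epsilon>) \<le> c / 2 * ?x" using x c by (intro mult_left_mono) auto
    then have ln: "ln (real n) \<le> c / 2 * ?x" using elim by simp
    have p: "0 \<le> c / real n ^ m" "c / real n ^ m \<le> 1"
    proof -
      have "1 \<le> real n ^ m" using elim by (intro one_le_power) auto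
      then have "c \<le> real n ^ m" using c by linarith
      then show "c / real n ^ m \<le> 1" using n(2) by simp
    qed (use c n in auto)
    have "(1 - c / real n ^ m) ^ N n \<le> exp (- (c / real n ^ m)) ^ N n"
      using p exp_ge_add_one_self[of "- (c / real n ^ m)"] by (intro power_mono) auto
    also have "\<dots> = exp (- (c * ?x))" by (simp add: exp_of_nat_mult[symmetric] mult_ac)
    finally have "real n * (1 - c / real n ^ m) ^ N n \<le> real n * exp (- (c * ?x))"
      using n by (intro mult_left_mono) auto
    also have "\<dots> = exp (ln (real n) - c * ?x)"
      using n by (simp add: exp_diff exp_minus divide_inverse)
    also have "\<dots> \<le> exp (- (c / 2 * ?x))" using ln by simp
    also have "- (c / 2 * ?x) = - (c / 2) * real (N n) / real n ^ m" by simp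
    finally have "real n * (1 - c / real n ^ m) ^ N n \<le> exp (- (c / 2) * real (N n) / real n ^ m)" .
    moreover have "1 - real n * (1 - c / real n ^ m) ^ N n \<le> success_prob gen sel (N n) n n"
      using elim Npos p supp[of n] impr[of n] by (intro success_prob_ge sel) auto
    ultimately show ?case by linarith
  qed
  then show ?thesis using c(1) by (intro exI[of _ "c / 2"]) auto
qed

theorem theorem1:
  fixes sel :: "nat \<Rightarrow> sol list \<Rightarrow> sol"
  assumes "valid_sel sel"
  shows "(\<forall>(\<epsilon>::real) (N::nat \<Rightarrow> nat). 0 < \<epsilon> \<and> \<epsilon> < 1 \<and>
            (\<lambda>n. real (N n)) \<in> \<Omega>(\<lambda>n. real n powr (5 + \<epsilon>)) \<longrightarrow>
            (\<exists>c>0. \<forall>\<^sub>F n in at_top.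
               success_prob vertex_gen sel (N n) n n \<ge> 1 - exp (- c * real (N n) / real n ^ 5)))
       \<and> (\<forall>(\<epsilon>::real) (N::nat \<Rightarrow> nat). 0 < \<epsilon> \<and> \<epsilon> < 1 \<and>
            (\<lambda>n. real (N n)) \<in> \<Omega>(\<lambda>n. real n powr (3 + \<epsilon>)) \<longrightarrow>
            (\<exists>c>0. \<forall>\<^sub>F n in at_top.
               success_prob edge_gen sel (N n) n n \<ge> 1 - exp (- c * real (N n) / real n ^ 3)))"
proof (intro conjI allI impI)
  fix \<epsilon> :: real and N :: "nat \<Rightarrow> nat"
  assume A: "0 < \<epsilon> \<and> \<epsilon> < 1 \<and> (\<lambda>n. real (N n)) \<in> \<Omega>(\<lambda>n. real n powr (5 + \<epsilon>))"
  show "\<exists>c>0. \<forall>\<^sub>F n in at_top.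
    success_prob vertex_gen sel (N n) n n \<ge> 1 - exp (- c * real (N n) / real n ^ 5)"
  proof (rule success_asymptotics[OF assms, where \<epsilon> = \<epsilon> and c = "exp (- 1) / 243"])
    show "exp (- 1) / 243 \<le> (1 :: real)"
      using exp_le_one_iff[of "- 1 :: real"] by linarith
    show "\<exists>H'. is_ham n H' \<and> level n H < level n H' \<and>
      exp (- 1) / 243 / real n ^ 5 \<le> pmf (vertex_gen n (pi_of n H)) H'"
      if "4 \<le> n" "is_ham n H" "improving n H" for n H
      using vertex_gen_improving[OF that(2) _ that(3)] that(1) by simp
  qed (use A set_vertex_gen in auto)
next
  fix \<epsilon> :: real and N :: "nat \<Rightarrow> nat"
  assume A: "0 < \<epsilon> \<and> \<epsilon> < 1 \<and> (\<lambda>n. real (N n)) \<in> \<Omega>(\<lambda>n. real n powr (3 + \<epsilon>))"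
  show "\<exists>c>0. \<forall>\<^sub>F n in at_top.
    success_prob edge_gen sel (N n) n n \<ge> 1 - exp (- c * real (N n) / real n ^ 3)"
  proof (rule success_asymptotics[OF assms, where \<epsilon> = \<epsilon> and c = "exp (- 48) / 18432"])
    show "exp (- 48) / 18432 \<le> (1 :: real)"
      using exp_le_one_iff[of "- 48 :: real"] by linarith
    show "\<exists>H'. is_ham n H' \<and> level n H < level n H' \<and>
      exp (- 48) / 18432 / real n ^ 3 \<le> pmf (edge_gen n (pi_of n H)) H'"
      if "4 \<le> n" "is_ham n H" "improving n H" for n H
      using edge_gen_improving[OF that(2,1,3)] .
    show "set_pmf (edge_gen n P) \<subseteq> {H. is_ham n H}"
      if "4 \<le> n" "\<And>i j. i \<noteq> j \<Longrightarrow> 0 < P i j" for n P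
      using that by (intro set_edge_gen) auto
  qed (use A in auto)
qed

end
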